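(* Let $\mathfrak A$ be a tree-automatic $\tau$-structure and let $\phi(x,y_1,\dots,y_n)$ be an $\mathsf{FO}(\exists^\infty)$-formula over $\tau$. Then there exists a finite set $\mathcal S^{\mathfrak A}_\phi$ of tree-automatic $\tau$-structures such that for every $\bar s\in A^n$ the induced substructure $\mathfrak A\restriction \phi^{\mathfrak A}(\cdot,\bar s)$ is a sum augmentation of finitely many structures, each of which is a tame box augmentation of elements of $\mathcal S^{\mathfrak A}_\phi$.
   Context: A signature $\tau$ is a finite set of relation symbols $R$ with arities $\mathrm{ar}(R)\ge 1$; a $\tau$-structure $\mathfrak A$ has universe $A$ and relations $R^{\mathfrak A}\subseteq A^{\mathrm{ar}(R)}$. For $B\subseteq A$, $\mathfrak A\restriction B$ is the induced substructure. $\mathsf{FO}(\exists^\infty)$ is first-order logic extended by the quantifier "there exist infinitely many". For a formula $\phi(x,y_1,\dots,y_n)$ and $\bar s\in A^n$, $\phi^{\mathfrak A}(\cdot,\bar s)=\{a\in A:\mathfrak A\models\phi(a,\bar s)\}$. Trees and automata: $\Sigma$ is a finite alphabet. A tree domain is a finite prefix-closed $D\subseteq\{0,1\}^*$; a $\Sigma$-tree is a map $t:D\to\Sigma$ with $D=\mathrm{dom}(t)$ a tree domain (the empty tree has empty domain). A (deterministic bottom-up) tree automaton $(Q,\iota,\delta,F)$ has finite state set $Q$, start state $\iota$, transition function $\delta:\Sigma\times Q\times Q\to Q$ and accepting set $F$; the state at a node $u\in\mathrm{dom}(t)$ is $\delta(t(u),q_{u0},q_{u1})$ where $q_v$ is the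 state at $v$, and the state at any $v\notin\mathrm{dom}(t)$ (a missing child, or the root of the empty tree) is $\iota$. The automaton accepts $t$ iff the state at the root $\varepsilon$ lies in $F$; a tree language is regular if recognised by such an automaton. With a fresh symbol $\Box$, the convolution $\otimes(t_1,\dots,t_n)$ is the $(\Sigma\cup\{\Box\})^n$-tree with domain $\bigcup_i\mathrm{dom}(t_i)$ whose label at $u$ is $(t_1'(u),\dots,t_n'(u))$, where $t_i'(u)=t_i(u)$ if $u\in\mathrm{dom}(t_i)$ and $\Box$ otherwise. A relation $R$ on $\Sigma$-trees is automatic if $\{\otimes\bar t:\bar t\in R\}$ is regular. A tree-automatic presentation of a $\tau$-structure $\mathfrak A$ consists of tree automata $\mathcal A$ and $(\mathcal A_R)_{R\in\tau}$ together with a bijection $\mu:A\to L(\mathcal A)$ such that $\mathcal A_R$ recognises $\{\otimes\mu(\bar a):\bar a\in R^{\mathfrak A}\}$ for every $R$; $\mathfrak A$ is tree-automatic if it has one. Augmentations: $\mathfrak A$ is a sum augmentation of $\tau$-structures $\mathfrak B_1,\dots,\mathfrak B_n$ if $A=A_1\uplus\dots\uplus A_n$ with $\mathfrak A\restriction A_i\cong\mathfrak B_i$ for all $i$. $\mathfrak A$ is a box augmentation of $\mathfrak B_1,\dots,\mathfrak B_n$ if there is a bijection $f:B_1\times\dots\times B_n\to A$ such that for every $j$ and every fixed choice of $x_i\in B_i$ ($i\ne j$) the map $b\mapsto f(x_1,\dots,x_{j-1},b,x_{j+1},\dots,x_n)$ is an embedding of $\mathfrak B_j$ into $\mathfrak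 A$ (injective, preserving and reflecting all relations). For a relation symbol $R$ of arity $r$, an $R$-colouring of a $\tau$-structure $\mathfrak B$ is a map $c:B^r\to Q$ into a finite set $Q$ such that for all $\bar t\in B^r$: $c(\bar t)\in c(R^{\mathfrak B})$ iff $\bar t\in R^{\mathfrak B}$. A box augmentation (via $f$) is tame if for every $R\in\tau$ (arity $r$) there are $R$-colourings $c_i:B_i^r\to Q_i$ of $\mathfrak B_i$ ($1\le i\le n$) such that the map $(f(\bar x_1),\dots,f(\bar x_r))\mapsto (c_i(x_{1,i},\dots,x_{r,i}))_{1\le i\le n}$ (where $\bar x_k=(x_{k,1},\dots,x_{k,n})$) is an $R$-colouring of $\mathfrak A$. *)

theory Defs
  imports Main
begin

definition signature :: "'r set \<Rightarrow> ('r \<Rightarrow> nat) \<Rightarrow> bool" where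
  "signature Tau ar \<longleftrightarrow> finite Tau \<and> (\<forall>R\<in>Tau. ar R \<ge> 1)"

record ('a, 'r) struc =
  uni :: "'a set"
  rels :: "'r \<Rightarrow> 'a list set"

definition tuples :: "'a set \<Rightarrow> nat \<Rightarrow> 'a list set" where
  "tuples U r = {xs. length xs = r \<and> set xs \<subseteq> U}"

definition struc_of :: "'r set \<Rightarrow> ('r \<Rightarrow> nat) \<Rightarrow> ('a, 'r) struc \<Rightarrow> bool" where
  "struc_of Tau ar A \<longleftrightarrow> (\<forall>R\<in>Tau. rels A R \<subseteq> tuples (uni A) (ar R))"

definition restrict :: "('a, 'r) struc \<Rightarrow> 'a set \<Rightarrow> ('a, 'r) struc" where
  "restrict A B = \<lparr>uni = B, rels = (\<lambda>R. {xs \<in> rels A R. set xs \<subseteq> B})\<rparr>"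

definition embedding :: "'r set \<Rightarrow> ('r \<Rightarrow> nat) \<Rightarrow> ('b, 'r) struc \<Rightarrow> ('a, 'r) struc \<Rightarrow> ('b \<Rightarrow> 'a) \<Rightarrow> bool" where
  "embedding Tau ar B A h \<longleftrightarrow> inj_on h (uni B) \<and> h ` uni B \<subseteq> uni A \<and>
     (\<forall>R\<in>Tau. \<forall>xs\<in>tuples (uni B) (ar R). xs \<in> rels B R \<longleftrightarrow> map h xs \<in> rels A R)"

definition iso :: "'r set \<Rightarrow> ('r \<Rightarrow> nat) \<Rightarrow> ('b, 'r) struc \<Rightarrow> ('a, 'r) struc \<Rightarrow> bool" where
  "iso Tau ar B A \<longleftrightarrow> (\<exists>h. bij_betw h (uni B) (uni A) \<and> embedding Tau ar B A h)"

definition sum_aug :: "'r set \<Rightarrow> ('r \<Rightarrow> nat) \<Rightarrow> ('a, 'r) struc \<Rightarrow> ('b, 'r) struc list \<Rightarrow> bool" where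
  "sum_aug Tau ar A Bs \<longleftrightarrow> (\<exists>As :: 'a set list. length As = length Bs \<and>
      (\<forall>i<length As. \<forall>j<length As. i \<noteq> j \<longrightarrow> As ! i \<inter> As ! j = {}) \<and>
      \<Union>(set As) = uni A \<and>
      (\<forall>i<length Bs. iso Tau ar (restrict A (As ! i)) (Bs ! i)))"

definition prod_set :: "('b, 'r) struc list \<Rightarrow> 'b list set" where
  "prod_set Bs = {xs. length xs = length Bs \<and> (\<forall>i<length Bs. xs ! i \<in> uni (Bs ! i))}"

definition box_aug :: "'r set \<Rightarrow> ('r \<Rightarrow> nat) \<Rightarrow> ('a, 'r) struc \<Rightarrow> ('b, 'r) struc list \<Rightarrow> ('b list \<Rightarrow> 'a) \<Rightarrow> bool" where
  "box_aug Tau ar A Bs f \<longleftrightarrow> bij_betw f (prod_set Bs) (uni A) \<and>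
     (\<forall>j<length Bs. \<forall>xs\<in>prod_set Bs. embedding Tau ar (Bs ! j) A (\<lambda>b. f (xs[j := b])))"

definition colouring :: "('r \<Rightarrow> nat) \<Rightarrow> ('b, 'r) struc \<Rightarrow> 'r \<Rightarrow> ('b list \<Rightarrow> 'c) \<Rightarrow> bool" where
  "colouring ar B R c \<longleftrightarrow> finite (c ` tuples (uni B) (ar R)) \<and>
     (\<forall>t\<in>tuples (uni B) (ar R). c t \<in> c ` (rels B R \<inter> tuples (uni B) (ar R)) \<longleftrightarrow> t \<in> rels B R)"

definition tame_box_aug :: "'r set \<Rightarrow> ('r \<Rightarrow> nat) \<Rightarrow> ('a, 'r) struc \<Rightarrow> ('b, 'r) struc list \<Rightarrow> bool" where
  "tame_box_aug Tau ar A Bs \<longleftrightarrow> (\<exists>f. box_aug Tau ar A Bs f \<and>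
     (\<forall>R\<in>Tau. \<exists>cs :: nat \<Rightarrow> 'b list \<Rightarrow> nat.
        (\<forall>i<length Bs. colouring ar (Bs ! i) R (cs i)) \<and>
        colouring ar A R (\<lambda>t. map (\<lambda>i. cs i (map (\<lambda>k. inv_into (prod_set Bs) f (t ! k) ! i) [0..<ar R]))
                                 [0..<length Bs])))"

text \<open>Nodes are words over {0,1}, rendered as bool lists (False = 0, True = 1).
  A tree is a partial map from nodes to labels whose domain is a tree domain.\<close>

definition tree_dom :: "bool list set \<Rightarrow> bool" where
  "tree_dom D \<longleftrightarrow> finite D \<and> (\<forall>u v. u @ v \<in> D \<longrightarrow> u \<in> D)"

definition is_tree :: "'l set \<Rightarrow> (bool list \<Rightarrow> 'l option) \<Rightarrow> bool" where
  "is_tree Sg t \<longleftrightarrow> tree_dom (dom t) \<and> ran t \<subseteq> Sg"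

record 'l aut =
  states :: "nat set"
  init :: nat
  trans :: "'l \<Rightarrow> nat \<Rightarrow> nat \<Rightarrow> nat"
  final :: "nat set"

definition wf_aut :: "'l set \<Rightarrow> 'l aut \<Rightarrow> bool" where
  "wf_aut Sg M \<longleftrightarrow> finite (states M) \<and> init M \<in> states M \<and> final M \<subseteq> states M \<and>
     (\<forall>a\<in>Sg. \<forall>p\<in>states M. \<forall>q\<in>states M. trans M a p q \<in> states M)"

text \<open>The (unique, since trees are finite) run: state init outside the domain,
  and the transition applied to the label and the states of the children u0, u1.\<close>

definition is_run :: "'l aut \<Rightarrow> (bool list \<Rightarrow> 'l option) \<Rightarrow> (bool list \<Rightarrow> nat) \<Rightarrow> bool" where
  "is_run M t \<rho> \<longleftrightarrow> (\<forall>v. v \<notin> dom t \<longrightarrow> \<rho> v = init M) \<and>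
     (\<forall>u a. t u = Some a \<longrightarrow> \<rho> u = trans M a (\<rho> (u @ [False])) (\<rho> (u @ [True])))"

definition accepts :: "'l aut \<Rightarrow> (bool list \<Rightarrow> 'l option) \<Rightarrow> bool" where
  "accepts M t \<longleftrightarrow> (\<exists>\<rho>. is_run M t \<rho> \<and> \<rho> [] \<in> final M)"

definition lang :: "'l set \<Rightarrow> 'l aut \<Rightarrow> (bool list \<Rightarrow> 'l option) set" where
  "lang Sg M = {t. is_tree Sg t \<and> accepts M t}"

text \<open>Convolution: the padding symbol Box is None.\<close>

definition conv :: "(bool list \<Rightarrow> 'l option) list \<Rightarrow> (bool list \<Rightarrow> 'l option list option)" where
  "conv ts = (\<lambda>u. if (\<exists>t\<in>set ts. u \<in> dom t) then Some (map (\<lambda>t. t u) ts) else None)"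

definition conv_alph :: "'l set \<Rightarrow> nat \<Rightarrow> 'l option list set" where
  "conv_alph Sg n = {xs. length xs = n \<and> (\<forall>x\<in>set xs. x = None \<or> (\<exists>a\<in>Sg. x = Some a))}"

text \<open>Tree-automatic presentation (finite alphabets taken, w.l.o.g., as subsets of nat).\<close>

definition tree_automatic :: "'r set \<Rightarrow> ('r \<Rightarrow> nat) \<Rightarrow> ('a, 'r) struc \<Rightarrow> bool" where
  "tree_automatic Tau ar A \<longleftrightarrow>
    (\<exists>(Sg :: nat set) (M :: nat aut) (MR :: 'r \<Rightarrow> nat option list aut)
        (\<mu> :: 'a \<Rightarrow> bool list \<Rightarrow> nat option).
       finite Sg \<and> wf_aut Sg M \<and> bij_betw \<mu> (uni A) (lang Sg M) \<and>
       (\<forall>R\<in>Tau. wf_aut (conv_alph Sg (ar R)) (MR R) \<and>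
          lang (conv_alph Sg (ar R)) (MR R) = (\<lambda>xs. conv (map \<mu> xs)) ` rels A R))"

datatype 'r fo =
    Rel 'r "nat list"
  | Eq nat nat
  | Neg "'r fo"
  | Conj "'r fo" "'r fo"
  | Ex nat "'r fo"
  | ExInf nat "'r fo"

fun fo_over :: "'r set \<Rightarrow> ('r \<Rightarrow> nat) \<Rightarrow> 'r fo \<Rightarrow> bool" where
  "fo_over Tau ar (Rel R xs) = (R \<in> Tau \<and> length xs = ar R)"
| "fo_over Tau ar (Eq x y) = True"
| "fo_over Tau ar (Neg p) = fo_over Tau ar p"
| "fo_over Tau ar (Conj p q) = (fo_over Tau ar p \<and> fo_over Tau ar q)"
| "fo_over Tau ar (Ex x p) = fo_over Tau ar p"
| "fo_over Tau ar (ExInf x p) = fo_over Tau ar p"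

fun fv :: "'r fo \<Rightarrow> nat set" where
  "fv (Rel R xs) = set xs"
| "fv (Eq x y) = {x, y}"
| "fv (Neg p) = fv p"
| "fv (Conj p q) = fv p \<union> fv q"
| "fv (Ex x p) = fv p - {x}"
| "fv (ExInf x p) = fv p - {x}"

fun sat :: "('a, 'r) struc \<Rightarrow> (nat \<Rightarrow> 'a) \<Rightarrow> 'r fo \<Rightarrow> bool" where
  "sat A v (Rel R xs) = (map v xs \<in> rels A R)"
| "sat A v (Eq x y) = (v x = v y)"
| "sat A v (Neg p) = (\<not> sat A v p)"
| "sat A v (Conj p q) = (sat A v p \<and> sat A v q)"
| "sat A v (Ex x p) = (\<exists>a\<in>uni A. sat A (v(x := a)) p)"
| "sat A v (ExInf x p) = infinite {a \<in> uni A. sat A (v(x := a)) p}"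

text \<open>phi(x, y1..yn): variable 0 is x, variable i (1 \<le> i \<le> n) is y_i.\<close>

definition assign :: "'a \<Rightarrow> 'a list \<Rightarrow> nat \<Rightarrow> 'a" where
  "assign a s = (\<lambda>k. if k = 0 then a else if k \<le> length s then s ! (k - 1) else a)"

definition defset :: "('a, 'r) struc \<Rightarrow> 'r fo \<Rightarrow> 'a list \<Rightarrow> 'a set" where
  "defset A phi s = {a \<in> uni A. sat A (assign a s) phi}"

end

theory Submission
  imports Defs "HOL-Library.Countable_Set"
begin

text \<open>
  Fix parameters \<open>s\<close> and let \<open>D\<close> be the union of the domains of their
  trees. A deterministic automaton reading \<open>t\<close> together with the trees of
  \<open>s\<close> sees only \<open>t\<close> once it is below \<open>D\<close>, so whether
  \<open>t\<close> satisfies the formula depends only on \<open>t\<close> inside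
  \<open>D\<close> and on the states reached on the subtrees of \<open>t\<close> at the nodes
  just below \<open>D\<close>. Fixing these data cuts the definable set into finitely many
  blocks, and each block is a product over the nodes just below \<open>D\<close> of regular sets
  of subtrees. If the states also include those of the relation automata on the diagonal tuples
  \<open>(t, \<dots>, t)\<close>, then a tuple varying in one coordinate only is related iff the
  state of the relation automaton in that coordinate lies in a certain set of states. So each
  factor is one of finitely many structures, and the states of the relation automata are the
  colourings witnessing tameness.

  Automata are handled through the functions mapping a valuation of the variables by trees to
  the state reached: such a function has finite range, and its value is determined by the root
  labels and the values at the two children. This class is closed under all logical operations
  without any treatment of padding.
\<close>

section \<open>Trees and runs\<close>

type_synonym 'l ltree = "bool list \<Rightarrow> 'l option"

definition sub :: "bool list \<Rightarrow> 'l ltree \<Rightarrow> 'l ltree" where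
  "sub u t = (\<lambda>w. t (u @ w))"

text \<open>The root label is optional so that empty and nonempty trees are handled alike. With
  \<open>l = None\<close> the result is a tree only if both children are empty, which is the side
  condition in \<open>is_tree_node\<close>.\<close>

definition node :: "'l option \<Rightarrow> 'l ltree \<Rightarrow> 'l ltree \<Rightarrow> 'l ltree" where
  "node l t0 t1 = (\<lambda>w. case w of [] \<Rightarrow> l | b # w' \<Rightarrow> (if b then t1 else t0) w')"

lemma sub_Nil [simp]: "sub [] t = t"
  by (simp add: sub_def)

lemma sub_sub [simp]: "sub v (sub u t) = sub (u @ v) t"
  by (simp add: sub_def)

lemma sub_empty [simp]: "sub u Map.empty = Map.empty"
  by (simp add: sub_def)

lemma sub_root [simp]: "sub u t [] = t u"
  by (simp add: sub_def)

lemma node_root [simp]: "node l t0 t1 [] = l"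
  by (simp add: node_def)

lemma node_Cons [simp]: "node l t0 t1 (b # w) = (if b then t1 else t0) w"
  by (simp add: node_def)

lemma sub_node [simp]: "sub [b] (node l t0 t1) = (if b then t1 else t0)"
  by (simp add: sub_def node_def fun_eq_iff)

lemma tree_eqI:
  assumes "s [] = t []" "\<And>b. sub [b] s = sub [b] t"
  shows "s = t"
proof
  fix w show "s w = t w"
    using assms(1) fun_cong[OF assms(2)] by (cases w) (auto simp: sub_def)
qed

lemma is_tree_empty [simp]: "is_tree Sg Map.empty"
  by (simp add: is_tree_def tree_dom_def)

lemma is_tree_prefix:
  assumes "is_tree Sg t" "t u = None"
  shows "t (u @ w) = None"
  using assms unfolding is_tree_def tree_dom_def by (meson domIff)

lemma is_tree_label:
  "is_tree Sg t \<Longrightarrow> t u = Some a \<Longrightarrow> a \<in> Sg"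
  unfolding is_tree_def by (auto intro: ranI)

lemma sub_outside:
  "is_tree Sg t \<Longrightarrow> t u = None \<Longrightarrow> sub u t = Map.empty"
  by (simp add: sub_def fun_eq_iff is_tree_prefix)

lemma root_None_iff:
  "is_tree Sg t \<Longrightarrow> t [] = None \<longleftrightarrow> t = Map.empty"
  using sub_outside[of Sg t "[]"] by auto

lemma is_tree_sub:
  assumes "is_tree Sg t"
  shows "is_tree Sg (sub u t)"
proof -
  have "dom (sub u t) = (@) u -` dom t"
    by (auto simp: sub_def)
  then have "finite (dom (sub u t))"
    using assms by (auto simp: is_tree_def tree_dom_def intro!: finite_vimageI injI)
  moreover have "ran (sub u t) \<subseteq> ran t"
    by (auto simp: sub_def ran_def)
  ultimately show ?thesis
    using assms unfolding is_tree_def tree_dom_def sub_def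
    by (metis (no_types, lifting) append.assoc domIff order_trans)
qed

lemma is_tree_node:
  assumes "is_tree Sg t0" "is_tree Sg t1"
    and "\<And>a. l = Some a \<Longrightarrow> a \<in> Sg"
    and "l = None \<Longrightarrow> t0 = Map.empty \<and> t1 = Map.empty"
  shows "is_tree Sg (node l t0 t1)"
proof (cases l)
  case None
  then have "node l t0 t1 = Map.empty"
    using assms(4) by (auto simp: node_def fun_eq_iff split: list.split)
  then show ?thesis by simp
next
  case (Some a)
  have "dom (node l t0 t1) \<subseteq> {[]} \<union> (#) False ` dom t0 \<union> (#) True ` dom t1"
  proof
    fix w assume "w \<in> dom (node l t0 t1)"
    then show "w \<in> {[]} \<union> (#) False ` dom t0 \<union> (#) True ` dom t1"
      by (cases w) (auto simp: image_iff domIff split: if_splits)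
  qed
  then have "finite (dom (node l t0 t1))"
    by (rule finite_subset) (use assms(1,2) in \<open>simp add: is_tree_def tree_dom_def\<close>)
  moreover have "u \<in> dom (node l t0 t1)" if "u @ v \<in> dom (node l t0 t1)" for u v
  proof (cases u)
    case Nil
    then show ?thesis using Some by (simp add: domIff)
  next
    case (Cons b u')
    define t where "t = (if b then t1 else t0)"
    have "is_tree Sg t" using assms(1,2) by (simp add: t_def)
    moreover have "node l t0 t1 (b # w) = t w" for w
      by (simp add: node_def t_def)
    ultimately show ?thesis
      using that is_tree_prefix[of Sg t u' v] by (auto simp: Cons domIff simp del: not_None_eq)
  qed
  moreover have "ran (node l t0 t1) \<subseteq> Sg"
  proof
    fix a assume "a \<in> ran (node l t0 t1)"
    then obtain w where w: "node l t0 t1 w = Some a" by (auto simp: ran_def)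
    show "a \<in> Sg"
      using w assms(1-3) is_tree_label by (cases w) (auto split: if_splits)
  qed
  ultimately show ?thesis
    by (auto simp: is_tree_def tree_dom_def)
qed

text \<open>Trees are partial functions and not a datatype, so structural induction is recovered
  from the number of nodes, which drops from a nonempty tree to its children.\<close>

lemma tree_induct [consumes 1, case_names empty node]:
  assumes "is_tree Sg t"
    and "P Map.empty"
    and "\<And>a t. is_tree Sg t \<Longrightarrow> t [] = Some a \<Longrightarrow> a \<in> Sg \<Longrightarrow> (\<And>b. P (sub [b] t)) \<Longrightarrow> P t"
  shows "P t"
  using assms(1)
proof (induction "card (dom t)" arbitrary: t rule: less_induct)
  case less
  show ?case
  proof (cases "t []")
    case None
    then show ?thesis
      using assms(2) root_None_iff[OF less.prems] by simp
  next
    case (Some a)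
    have fin: "finite (dom t)"
      using less.prems by (simp add: is_tree_def tree_dom_def)
    have "card (dom (sub [b] t)) < card (dom t)" for b
    proof -
      have "(#) b ` dom (sub [b] t) \<subset> dom t"
        using Some by (force simp: sub_def)
      then have "card ((#) b ` dom (sub [b] t)) < card (dom t)"
        by (rule psubset_card_mono[OF fin])
      then show ?thesis by (simp add: card_image)
    qed
    then have "P (sub [b] t)" for b
      by (rule less.hyps) (rule is_tree_sub[OF less.prems])
    then show ?thesis
      by (rule assms(3)[OF less.prems Some is_tree_label[OF less.prems Some]])
  qed
qed

text \<open>The factor structures have to live over \<open>nat\<close>, so trees need a numbering. A
  finite map is \<open>map_of\<close> of some list, and lists over a countable type are
  countable.\<close>

lemma countable_trees: "countable {t. is_tree (Sg :: 'l :: countable set) t}"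
proof -
  have "t \<in> range map_of" if "finite (dom t)" for t :: "'l ltree"
    using that
  proof (induction rule: finite_Map_induct)
    case empty
    show ?case by (simp add: image_iff exI[of _ "[]"])
  next
    case (update k v m)
    then show ?case by (metis map_of.simps(2) fst_conv snd_conv rangeE rangeI)
  qed
  then have "{t :: 'l ltree. is_tree Sg t} \<subseteq> range map_of"
    by (auto simp: is_tree_def tree_dom_def)
  then show ?thesis
    by (rule countable_subset) simp
qed

section \<open>Root states of runs\<close>

definition run_state :: "'l aut \<Rightarrow> 'l ltree \<Rightarrow> nat" where
  "run_state M t = (SOME \<rho>. is_run M t \<rho>) []"

lemma is_run_sub: "is_run M t \<rho> \<Longrightarrow> is_run M (sub [b] t) (\<lambda>w. \<rho> (b # w))"
  by (auto simp: is_run_def sub_def domIff)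

lemma is_run_unique:
  assumes "is_tree Sg t" "is_run M t \<rho>" "is_run M t \<rho>'"
  shows "\<rho> [] = \<rho>' []"
  using assms
proof (induction arbitrary: \<rho> \<rho>' rule: tree_induct)
  case empty
  then show ?case by (simp add: is_run_def)
next
  case (node a t)
  have "\<rho> [b] = \<rho>' [b]" for b
    using node.IH[OF is_run_sub is_run_sub] node.prems by fastforce
  then show ?case
    using node.prems node.hyps by (simp add: is_run_def)
qed

lemma ex_run:
  assumes "is_tree Sg t"
  shows "\<exists>\<rho>. is_run M t \<rho>"
  using assms
proof (induction rule: tree_induct)
  case empty
  show ?case by (rule exI[of _ "\<lambda>_. init M"]) (simp add: is_run_def)
next
  case (node a t)
  then obtain r where r: "\<And>b. is_run M (sub [b] t) (r b)" by metis
  let ?r = "\<lambda>w. case w of [] \<Rightarrow> trans M a (r False []) (r True []) | b # w' \<Rightarrow> r b w'"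
  have "is_run M t ?r"
    using r node.hyps unfolding is_run_def sub_def
    by (auto split: list.split)
  then show ?case by blast
qed

lemma run_state_eq:
  assumes "is_tree Sg t" "is_run M t \<rho>"
  shows "run_state M t = \<rho> []"
  unfolding run_state_def
  using is_run_unique[OF assms(1) someI_ex[OF ex_run[OF assms(1)]] assms(2)] .

lemma run_state_empty [simp]: "run_state M Map.empty = init M"
  using run_state_eq[OF is_tree_empty, of M "\<lambda>_. init M"] by (simp add: is_run_def)

lemma run_state_node:
  assumes "is_tree Sg t" "t [] = Some a"
  shows "run_state M t = trans M a (run_state M (sub [False] t)) (run_state M (sub [True] t))"
proof -
  obtain \<rho> where \<rho>: "is_run M t \<rho>" using ex_run[OF assms(1)] by blast
  have "run_state M (sub [b] t) = \<rho> [b]" for b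
    using run_state_eq[OF is_tree_sub[OF assms(1)] is_run_sub[OF \<rho>]] .
  then show ?thesis
    using run_state_eq[OF assms(1) \<rho>] \<rho> assms(2) by (simp add: is_run_def)
qed

lemma lang_run_state: "lang Sg M = {t. is_tree Sg t \<and> run_state M t \<in> final M}"
  unfolding lang_def accepts_def by (metis ex_run run_state_eq)

lemma run_state_in_states:
  assumes "wf_aut Sg M" "is_tree Sg t"
  shows "run_state M t \<in> states M"
  using assms(2)
proof (induction rule: tree_induct)
  case empty
  then show ?case using assms(1) by (simp add: wf_aut_def)
next
  case (node a t)
  then show ?case
    using assms(1) run_state_node[OF node.hyps(1,2)] by (simp add: wf_aut_def)
qed

section \<open>Finite congruences\<close>

text \<open>The kernel of such a \<open>g\<close> is a congruence of finite index in the sense of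
  Myhill and Nerode. Values of any type are allowed, so products need no coding; comparing root
  labels as options includes the empty tree.\<close>

definition tree_congr :: "'l set \<Rightarrow> ('l ltree \<Rightarrow> 'q) \<Rightarrow> bool" where
  "tree_congr Sg g \<longleftrightarrow> finite (g ` {t. is_tree Sg t}) \<and>
     (\<forall>t t'. is_tree Sg t \<longrightarrow> is_tree Sg t' \<longrightarrow> t [] = t' [] \<longrightarrow>
        (\<forall>b. g (sub [b] t) = g (sub [b] t')) \<longrightarrow> g t = g t')"

lemma tree_congr_finite: "tree_congr Sg g \<Longrightarrow> finite (g ` {t. is_tree Sg t})"
  by (simp only: tree_congr_def)

lemma tree_congrD:
  "tree_congr Sg g \<Longrightarrow> is_tree Sg t \<Longrightarrow> is_tree Sg t' \<Longrightarrow> t [] = t' [] \<Longrightarrow>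
    (\<And>b. g (sub [b] t) = g (sub [b] t')) \<Longrightarrow> g t = g t'"
  unfolding tree_congr_def by blast

lemma tree_congr_run_state:
  assumes "wf_aut Sg M"
  shows "tree_congr Sg (run_state M)"
  unfolding tree_congr_def
proof (intro conjI allI impI)
  show "finite (run_state M ` {t. is_tree Sg t})"
    by (rule finite_subset[of _ "states M"])
      (use assms run_state_in_states in \<open>auto simp: wf_aut_def\<close>)
next
  fix t t'
  assume "is_tree Sg t" "is_tree Sg t'" "t [] = t' []"
    "\<forall>b. run_state M (sub [b] t) = run_state M (sub [b] t')"
  then show "run_state M t = run_state M t'"
    using root_None_iff[of Sg t] root_None_iff[of Sg t']
    by (cases "t []") (auto simp: run_state_node)
qed

text \<open>The Myhill-Nerode construction: the values of \<open>g\<close>, coded as numbers, are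
  the states; a transition joins representatives of two values under a new root and applies
  \<open>g\<close>. The congruence property makes the outcome independent of the
  representatives.\<close>

lemma tree_congr_regular:
  assumes "tree_congr Sg g"
  shows "\<exists>M. wf_aut Sg M \<and> lang Sg M = {t. is_tree Sg t \<and> g t \<in> F}"
proof -
  define Q where "Q = g ` {t. is_tree Sg t}"
  have fin: "finite Q"
    using tree_congr_finite[OF assms] by (simp add: Q_def)
  obtain i :: "'b \<Rightarrow> nat" where i: "inj_on i Q"
    using finite_imp_inj_to_nat_seg[OF fin] by blast
  define rep where "rep p = (SOME t. is_tree Sg t \<and> i (g t) = p)" for p
  have rep: "is_tree Sg (rep p) \<and> i (g (rep p)) = p" if "p \<in> i ` Q" for p
    unfolding rep_def using that by (intro someI_ex[where P = "\<lambda>t. is_tree Sg t \<and> i (g t) = p"]) (auto simp: Q_def)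
  \<comment> \<open>The code \<open>i\<close> is injective on \<open>Q\<close> only, so the
    accepting values are cut down to \<open>F \<inter> Q\<close>; this also keeps
    \<open>final M\<close> inside \<open>states M\<close>.\<close>
  define M where "M = \<lparr>states = i ` Q, init = i (g Map.empty),
     trans = (\<lambda>a p q. i (g (node (Some a) (rep p) (rep q)))), final = i ` (F \<inter> Q)\<rparr>"
  have gQ: "g t \<in> Q" if "is_tree Sg t" for t
    using that by (auto simp: Q_def)
  have wf: "wf_aut Sg M"
    unfolding wf_aut_def M_def using fin by (auto intro!: imageI gQ is_tree_node simp: rep)
  have "run_state M t = i (g t)" if "is_tree Sg t" for t
    using that
  proof (induction rule: tree_induct)
    case empty
    then show ?case by (simp add: M_def)
  next
    case (node a t)
    let ?p = "\<lambda>b. i (g (sub [b] t))"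
    have p: "?p b \<in> i ` Q" for b
      using gQ is_tree_sub[OF node.hyps(1)] by blast
    have "g (rep (?p b)) = g (sub [b] t)" for b
      using rep[OF p] i gQ is_tree_sub[OF node.hyps(1)] by (metis inj_onD)
    then have "g (node (Some a) (rep (?p False)) (rep (?p True))) = g t"
      using rep[OF p] node.hyps
      by - (rule tree_congrD[OF assms], auto intro!: is_tree_node)
    then show ?case
      using run_state_node[OF node.hyps(1,2)] node.IH by (simp add: M_def)
  qed
  moreover have "i (g t) \<in> final M \<longleftrightarrow> g t \<in> F" if "is_tree Sg t" for t
    using inj_on_image_mem_iff[OF i gQ[OF that], of "F \<inter> Q"] gQ[OF that] by (simp add: M_def)
  ultimately have "lang Sg M = {t. is_tree Sg t \<and> g t \<in> F}"
    unfolding lang_run_state by auto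
  with wf show ?thesis by blast
qed

lemma tree_congr_Pair:
  assumes "tree_congr Sg g" "tree_congr Sg g'"
  shows "tree_congr Sg (\<lambda>t. (g t, g' t))"
proof -
  have "finite ((\<lambda>t. (g t, g' t)) ` {t. is_tree Sg t})"
    by (rule finite_subset[of _ "g ` {t. is_tree Sg t} \<times> g' ` {t. is_tree Sg t}"])
      (use assms in \<open>auto simp: tree_congr_finite\<close>)
  then show ?thesis
    using assms unfolding tree_congr_def by blast
qed

lemma tree_congr_empty: "tree_congr Sg (\<lambda>t. t = Map.empty)"
  unfolding tree_congr_def by (auto simp: root_None_iff[symmetric])

section \<open>Congruences on valuations of the variables\<close>

definition vals :: "'l set \<Rightarrow> (nat \<Rightarrow> 'l ltree) set" where
  "vals Sg = {v. \<forall>x. is_tree Sg (v x)}"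

text \<open>All variables descend to the same child simultaneously, as in a deterministic automaton
  on tuples of trees. Padding symbols do not arise: an exhausted tree just continues as the empty
  tree.\<close>

definition val_congr :: "'l set \<Rightarrow> ((nat \<Rightarrow> 'l ltree) \<Rightarrow> 'q) \<Rightarrow> bool" where
  "val_congr Sg h \<longleftrightarrow> finite (h ` vals Sg) \<and>
     (\<forall>v\<in>vals Sg. \<forall>v'\<in>vals Sg. (\<forall>x. v x [] = v' x []) \<longrightarrow>
        (\<forall>b. h (\<lambda>x. sub [b] (v x)) = h (\<lambda>x. sub [b] (v' x))) \<longrightarrow> h v = h v')"

lemma val_congr_finite: "val_congr Sg h \<Longrightarrow> finite (h ` vals Sg)"
  by (simp only: val_congr_def)

lemma val_congrD:
  "val_congr Sg h \<Longrightarrow> v \<in> vals Sg \<Longrightarrow> v' \<in> vals Sg \<Longrightarrow> (\<And>x. v x [] = v' x []) \<Longrightarrow>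
    (\<And>b. h (\<lambda>x. sub [b] (v x)) = h (\<lambda>x. sub [b] (v' x))) \<Longrightarrow> h v = h v'"
  unfolding val_congr_def by blast

lemma vals_sub: "v \<in> vals Sg \<Longrightarrow> (\<lambda>x. sub u (v x)) \<in> vals Sg"
  by (simp add: vals_def is_tree_sub)

lemma vals_upd: "v \<in> vals Sg \<Longrightarrow> is_tree Sg t \<Longrightarrow> v(x := t) \<in> vals Sg"
  by (simp add: vals_def)

lemma val_congr_Pair:
  assumes "val_congr Sg h" "val_congr Sg h'"
  shows "val_congr Sg (\<lambda>v. (h v, h' v))"
proof -
  have "finite ((\<lambda>v. (h v, h' v)) ` vals Sg)"
    by (rule finite_subset[of _ "h ` vals Sg \<times> h' ` vals Sg"])
      (use assms in \<open>auto simp: val_congr_finite\<close>)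
  then show ?thesis
    using assms unfolding val_congr_def by blast
qed

text \<open>Finitely many congruences are run in parallel. The fixed default outside
  \<open>I\<close> keeps the set of resulting functions finite.\<close>

lemma val_congr_family:
  assumes "finite I" "\<And>i. i \<in> I \<Longrightarrow> val_congr Sg (h i)"
  shows "val_congr Sg (\<lambda>v i. if i \<in> I then h i v else undefined)"
proof -
  let ?B = "\<Union>i\<in>I. h i ` vals Sg"
  have "(\<lambda>v i. if i \<in> I then h i v else undefined) ` vals Sg \<subseteq>
      {f. \<forall>i. (i \<in> I \<longrightarrow> f i \<in> ?B) \<and> (i \<notin> I \<longrightarrow> f i = undefined)}"
    by auto blast
  moreover have "finite {f. \<forall>i. (i \<in> I \<longrightarrow> f i \<in> ?B) \<and> (i \<notin> I \<longrightarrow> f i = undefined)}"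
    by (rule finite_set_of_finite_funs) (use assms in \<open>auto intro!: val_congr_finite\<close>)
  ultimately have fin: "finite ((\<lambda>v i. if i \<in> I then h i v else undefined) ` vals Sg)"
    by (rule finite_subset)
  have eq: "h i v = h i v'"
    if "i \<in> I" "v \<in> vals Sg" "v' \<in> vals Sg" "\<forall>x. v x [] = v' x []"
      "\<forall>b. (\<lambda>i. if i \<in> I then h i (\<lambda>x. sub [b] (v x)) else undefined) =
           (\<lambda>i. if i \<in> I then h i (\<lambda>x. sub [b] (v' x)) else undefined)" for i v v'
  proof (rule val_congrD[OF assms(2)])
    show "h i (\<lambda>x. sub [b] (v x)) = h i (\<lambda>x. sub [b] (v' x))" for b
      using that(1) fun_cong[OF spec[OF that(5), of b], of i] by simp
  qed (use that(1-4) in auto)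
  show ?thesis
    unfolding val_congr_def
  proof (intro conjI ballI impI ext, rule fin, goal_cases)
    case (1 v v' i)
    show ?case using eq[of i v v', OF _ 1] by simp
  qed
qed

lemma val_congr_component:
  assumes "tree_congr Sg g"
  shows "val_congr Sg (\<lambda>v. g (v x))"
proof -
  have "finite ((\<lambda>v. g (v x)) ` vals Sg)"
    by (rule finite_subset[of _ "g ` {t. is_tree Sg t}"])
      (use assms in \<open>auto simp: tree_congr_finite vals_def\<close>)
  then show ?thesis
    using tree_congrD[OF assms] unfolding val_congr_def by (simp add: vals_def)
qed

lemma val_congr_inj:
  assumes "val_congr Sg h" "inj_on i (h ` vals Sg)"
  shows "val_congr Sg (\<lambda>v. i (h v))"
proof -
  have "finite ((\<lambda>v. i (h v)) ` vals Sg)"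
    using finite_imageI[OF val_congr_finite[OF assms(1)], of i] by (simp add: image_image)
  moreover have "h v = h v'" if "v \<in> vals Sg" "v' \<in> vals Sg" "i (h v) = i (h v')" for v v'
    using that assms(2) by (auto dest: inj_onD)
  ultimately show ?thesis
    using assms(1) unfolding val_congr_def by (metis vals_sub)
qed

text \<open>The empty tree has only empty subtrees, so the substitution commutes with passing to a
  child. It models a node outside all parameter trees, where only \<open>t\<close> is still
  visible.\<close>

lemma tree_congr_of_val_congr:
  assumes "val_congr Sg h"
  shows "tree_congr Sg (\<lambda>t. h (\<lambda>x. if P x then Map.empty else t))"
proof -
  let ?v = "\<lambda>t x. if P x then Map.empty else t"
  have v: "?v t \<in> vals Sg" if "is_tree Sg t" for t
    using that by (simp add: vals_def)
  have "finite ((\<lambda>t. h (?v t)) ` {t. is_tree Sg t})"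
    by (rule finite_subset[of _ "h ` vals Sg"])
      (use assms v in \<open>auto simp: val_congr_finite\<close>)
  moreover have sub: "(\<lambda>x. sub [b] (?v t x)) = ?v (sub [b] t)" for b t
    by auto
  have "h (?v t) = h (?v t')"
    if "is_tree Sg t" "is_tree Sg t'" "t [] = t' []" "\<forall>b. h (?v (sub [b] t)) = h (?v (sub [b] t'))"
    for t t'
    by (rule val_congrD[OF assms v v]) (use that in \<open>simp_all add: sub\<close>)
  ultimately show ?thesis
    unfolding tree_congr_def by blast
qed

section \<open>Convolutions as trees\<close>

lemma conv_root: "conv ts [] = (if \<exists>t\<in>set ts. t [] \<noteq> None then Some (map (\<lambda>t. t []) ts) else None)"
  by (auto simp: conv_def domIff)

lemma sub_conv: "sub u (conv ts) = conv (map (sub u) ts)"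
  by (auto simp: sub_def conv_def domIff fun_eq_iff)

lemma tree_dom_UN:
  assumes "finite I" "\<And>i. i \<in> I \<Longrightarrow> tree_dom (D i)"
  shows "tree_dom (\<Union>i\<in>I. D i)"
  unfolding tree_dom_def
proof (intro conjI allI impI)
  show "finite (\<Union>i\<in>I. D i)"
    by (rule finite_UN_I) (use assms in \<open>simp_all add: tree_dom_def\<close>)
  fix u v assume "u @ v \<in> (\<Union>i\<in>I. D i)"
  then obtain i where i: "i \<in> I" "u @ v \<in> D i" by (rule UN_E)
  then have "u \<in> D i"
    using assms(2)[OF i(1)] unfolding tree_dom_def by blast
  with i(1) show "u \<in> (\<Union>i\<in>I. D i)" by (rule UN_I[of i _ _ D])
qed

lemma is_tree_conv:
  assumes "\<And>t. t \<in> set ts \<Longrightarrow> is_tree Sg t" "length ts = r"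
  shows "is_tree (conv_alph Sg r) (conv ts)"
proof -
  have dom: "dom (conv ts) = (\<Union>t\<in>set ts. dom t)"
    by (auto simp: conv_def dom_def split: if_splits)
  have td: "tree_dom (dom t)" if "t \<in> set ts" for t
    using assms(1)[OF that] by (simp add: is_tree_def)
  have "tree_dom (dom (conv ts))"
    unfolding dom using td by (rule tree_dom_UN[OF finite_set])
  moreover have "ran (conv ts) \<subseteq> conv_alph Sg r"
  proof
    fix l assume "l \<in> ran (conv ts)"
    then obtain u where l: "l = map (\<lambda>t. t u) ts"
      by (auto simp: conv_def ran_def split: if_splits)
    have "t u = None \<or> (\<exists>a\<in>Sg. t u = Some a)" if "t \<in> set ts" for t
      using is_tree_label[OF assms(1)[OF that]] by (cases "t u") auto
    then show "l \<in> conv_alph Sg r"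
      using assms(2) by (auto simp: l conv_alph_def)
  qed
  ultimately show ?thesis by (simp add: is_tree_def)
qed

text \<open>Convolution commutes with taking subtrees, and its root label is a function of the root
  labels of the components; so an automaton on convolutions acts as a congruence on
  valuations.\<close>

lemma val_congr_conv:
  assumes "tree_congr (conv_alph Sg (length xs)) g"
  shows "val_congr Sg (\<lambda>v. g (conv (map v xs)))"
proof -
  have tree: "is_tree (conv_alph Sg (length xs)) (conv (map v xs))" if "v \<in> vals Sg" for v
    using that by (intro is_tree_conv) (auto simp: vals_def)
  have "finite ((\<lambda>v. g (conv (map v xs))) ` vals Sg)"
    by (rule finite_subset[of _ "g ` {t. is_tree (conv_alph Sg (length xs)) t}"])
      (use assms tree in \<open>auto simp: tree_congr_finite\<close>)
  moreover have "g (conv (map v xs)) = g (conv (map v' xs))"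
    if "v \<in> vals Sg" "v' \<in> vals Sg" "\<forall>x. v x [] = v' x []"
      "\<forall>b. g (conv (map (\<lambda>x. sub [b] (v x)) xs)) = g (conv (map (\<lambda>x. sub [b] (v' x)) xs))" for v v'
    by (rule tree_congrD[OF assms tree tree])
      (use that in \<open>auto simp: conv_root sub_conv comp_def\<close>)
  ultimately show ?thesis
    unfolding val_congr_def by blast
qed

section \<open>Recognisable predicates on valuations\<close>

definition recognisable :: "'l set \<Rightarrow> ((nat \<Rightarrow> 'l ltree) \<Rightarrow> bool) \<Rightarrow> bool" where
  "recognisable Sg P \<longleftrightarrow> (\<exists>(h :: (nat \<Rightarrow> 'l ltree) \<Rightarrow> nat) F. val_congr Sg h \<and>
     (\<forall>v\<in>vals Sg. P v \<longleftrightarrow> h v \<in> F))"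

text \<open>The definition fixes \<open>nat\<close> as the type of values, since types cannot be
  quantified there. An injective code of the finite range admits congruences with values of any
  type.\<close>

lemma recognisableI:
  assumes "val_congr Sg h" "\<And>v. v \<in> vals Sg \<Longrightarrow> P v \<longleftrightarrow> h v \<in> F"
  shows "recognisable Sg P"
proof -
  obtain i :: "_ \<Rightarrow> nat" where i: "inj_on i (h ` vals Sg)"
    using finite_imp_inj_to_nat_seg[OF val_congr_finite[OF assms(1)]] by blast
  have "P v \<longleftrightarrow> i (h v) \<in> i ` (F \<inter> h ` vals Sg)" if "v \<in> vals Sg" for v
    using inj_on_image_mem_iff[OF i, of "h v" "F \<inter> h ` vals Sg"] assms(2)[OF that] that by auto
  then show ?thesis
    unfolding recognisable_def using val_congr_inj[OF assms(1) i] by blast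
qed

lemma recognisable_Not:
  "recognisable Sg P \<Longrightarrow> recognisable Sg (\<lambda>v. \<not> P v)"
  unfolding recognisable_def by (metis ComplI ComplD)

lemma recognisable_conj:
  assumes "recognisable Sg P" "recognisable Sg P'"
  shows "recognisable Sg (\<lambda>v. P v \<and> P' v)"
proof -
  obtain h :: "_ \<Rightarrow> nat" and F and h' :: "_ \<Rightarrow> nat" and F'
    where "val_congr Sg h" "\<forall>v\<in>vals Sg. P v \<longleftrightarrow> h v \<in> F"
      and "val_congr Sg h'" "\<forall>v\<in>vals Sg. P' v \<longleftrightarrow> h' v \<in> F'"
    using assms unfolding recognisable_def by blast
  then show ?thesis
    by (intro recognisableI[OF val_congr_Pair, of Sg h h' _ "F \<times> F'"]) auto
qed

text \<open>Equality is its own two-valued congruence: two trees agree iff their roots and their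
  corresponding children agree.\<close>

lemma recognisable_eq: "recognisable Sg (\<lambda>v. v x = v y)"
proof (rule recognisableI[where h = "\<lambda>v. v x = v y" and F = "{True}"])
  have "v x = v y \<longleftrightarrow> v' x = v' y"
    if "\<forall>x. v x [] = v' x []"
      "\<forall>b. (sub [b] (v x) = sub [b] (v y)) = (sub [b] (v' x) = sub [b] (v' y))" for v v' :: "nat \<Rightarrow> 'a ltree"
    using that by (metis tree_eqI)
  then show "val_congr Sg (\<lambda>v. v x = v y)"
    unfolding val_congr_def by auto
qed simp

lemma recognisable_lang:
  assumes "wf_aut Sg M"
  shows "recognisable Sg (\<lambda>v. v x \<in> lang Sg M)"
  by (rule recognisableI[OF val_congr_component[OF tree_congr_run_state[OF assms]], of _ x "final M"])
    (simp add: lang_run_state vals_def)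

lemma recognisable_conv:
  assumes "wf_aut (conv_alph Sg (length xs)) M"
  shows "recognisable Sg (\<lambda>v. conv (map v xs) \<in> lang (conv_alph Sg (length xs)) M)"
  by (rule recognisableI[OF val_congr_conv[OF tree_congr_run_state[OF assms]], of _ "final M"])
    (auto simp: lang_run_state vals_def intro!: is_tree_conv)

section \<open>Quantification over trees\<close>

definition fibre :: "'l set \<Rightarrow> ((nat \<Rightarrow> 'l ltree) \<Rightarrow> 'q) \<Rightarrow> nat \<Rightarrow> (nat \<Rightarrow> 'l ltree) \<Rightarrow> 'q \<Rightarrow> 'l ltree set" where
  "fibre Sg g x v q = {t. is_tree Sg t \<and> g (v(x := t)) = q}"

lemma sub_upd: "(\<lambda>y. sub u ((v(x := t)) y)) = (\<lambda>y. sub u (v y))(x := sub u t)"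
  by auto

lemma fibre_sub: "t \<in> fibre Sg g x v q \<Longrightarrow>
    sub u t \<in> fibre Sg g x (\<lambda>y. sub u (v y)) (g ((\<lambda>y. sub u (v y))(x := sub u t)))"
  by (simp add: fibre_def is_tree_sub)

text \<open>An exchange argument: the root label of the witness \<open>t\<close> is kept, and its
  children are replaced by any trees that have the same types relative to the children of
  \<open>v'\<close>.\<close>

lemma node_in_fibre:
  assumes g: "val_congr Sg g" and v: "v \<in> vals Sg" "v' \<in> vals Sg" "\<And>y. v y [] = v' y []"
    and t: "t \<in> fibre Sg g x v q" "t [] = Some a"
    and t': "\<And>b. t' b \<in> fibre Sg g x (\<lambda>y. sub [b] (v' y)) (g ((\<lambda>y. sub [b] (v y))(x := sub [b] t)))"
  shows "node (Some a) (t' False) (t' True) \<in> fibre Sg g x v' q"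
proof -
  let ?t = "node (Some a) (t' False) (t' True)"
  have tree: "is_tree Sg ?t"
    using t' t is_tree_label[of Sg t] by (auto intro!: is_tree_node simp: fibre_def)
  have sub: "sub [b] ?t = t' b" for b
    by (cases b) simp_all
  have "g (v'(x := ?t)) = g (v(x := t))"
  proof (rule val_congrD[OF g])
    show "g (\<lambda>y. sub [b] ((v'(x := ?t)) y)) = g (\<lambda>y. sub [b] ((v(x := t)) y))" for b
      using t'[of b] unfolding sub_upd sub by (simp add: fibre_def)
  qed (use v t tree in \<open>auto simp: vals_def fibre_def\<close>)
  then show ?thesis
    using t tree by (simp add: fibre_def)
qed

text \<open>A quantified variable ranges over arbitrarily large trees, so the congruence for
  \<open>\<exists>\<close> and \<open>\<exists>\<^sup>\<infinity>\<close> records which types are reached, which of them infinitely often, and the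
  type reached by the empty tree, which is the only choice at nodes where the witness stops.\<close>

lemma val_congr_fibre:
  assumes g: "val_congr Sg g" and Sg: "finite Sg"
  shows "val_congr Sg (\<lambda>v. ({q. fibre Sg g x v q \<noteq> {}}, {q. infinite (fibre Sg g x v q)},
           g (v(x := Map.empty))))"
proof -
  let ?Q = "g ` vals Sg"
  define h where "h v = ({q. fibre Sg g x v q \<noteq> {}}, {q. infinite (fibre Sg g x v q)},
           g (v(x := Map.empty)))" for v
  have Q: "q \<in> ?Q" if "v \<in> vals Sg" "fibre Sg g x v q \<noteq> {}" for v q
    using that by (auto simp: fibre_def intro!: imageI vals_upd)
  have fin: "finite (h ` vals Sg)"
  proof (rule finite_subset)
    show "h ` vals Sg \<subseteq> Pow ?Q \<times> Pow ?Q \<times> ?Q"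
    proof (rule image_subsetI)
      fix v assume v: "v \<in> vals Sg"
      moreover have "fibre Sg g x v q \<noteq> {}" if "infinite (fibre Sg g x v q)" for q
        using that by auto
      moreover have "g (v(x := Map.empty)) \<in> ?Q"
        using v by (auto intro!: imageI vals_upd)
      ultimately show "h v \<in> Pow ?Q \<times> Pow ?Q \<times> ?Q"
        using Q[OF v] unfolding h_def by blast
    qed
    show "finite (Pow ?Q \<times> Pow ?Q \<times> ?Q)"
      using val_congr_finite[OF g] by simp
  qed
  \<comment> \<open>One direction suffices: the assumptions are symmetric in \<open>v\<close> and
    \<open>v'\<close>, and exchanging the two gives the other.\<close>
  have step: "(fibre Sg g x v q \<noteq> {} \<longrightarrow> fibre Sg g x v' q \<noteq> {}) \<and>
      (infinite (fibre Sg g x v q) \<longrightarrow> infinite (fibre Sg g x v' q)) \<and>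
      g (v(x := Map.empty)) = g (v'(x := Map.empty))"
    if v: "v \<in> vals Sg" "v' \<in> vals Sg" "\<And>y. v y [] = v' y []"
      and h: "\<And>b. h (\<lambda>y. sub [b] (v y)) = h (\<lambda>y. sub [b] (v' y))" for v v' q
  proof (intro conjI impI)
    let ?v = "\<lambda>b y. sub [b] (v y)" and ?v' = "\<lambda>b y. sub [b] (v' y)"
    show empty: "g (v(x := Map.empty)) = g (v'(x := Map.empty))"
    proof (rule val_congrD[OF g])
      show "g (\<lambda>y. sub [b] ((v(x := Map.empty)) y)) = g (\<lambda>y. sub [b] ((v'(x := Map.empty)) y))" for b
        using h[of b] unfolding sub_upd by (simp add: h_def)
    qed (use v in \<open>auto simp: vals_upd\<close>)
    have ne: "fibre Sg g x (?v b) p \<noteq> {} \<longleftrightarrow> fibre Sg g x (?v' b) p \<noteq> {}"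
      and inf: "infinite (fibre Sg g x (?v b) p) \<longleftrightarrow> infinite (fibre Sg g x (?v' b) p)" for b p
      using h[of b] unfolding h_def by blast+
    show "fibre Sg g x v' q \<noteq> {}" if "fibre Sg g x v q \<noteq> {}"
    proof -
      from that obtain t where t: "t \<in> fibre Sg g x v q" by blast
      show ?thesis
      proof (cases "t []")
        \<comment> \<open>An empty witness has no root to which replaced children could be attached;
          the third component of \<open>h\<close> transfers its type instead.\<close>
        case None
        then have "t = Map.empty"
          using t root_None_iff[of Sg t] by (simp add: fibre_def)
        then show ?thesis
          using t empty is_tree_empty unfolding fibre_def by force
      next
        case (Some a)
        have "\<forall>b. \<exists>t'. t' \<in> fibre Sg g x (?v' b) (g ((?v b)(x := sub [b] t)))"
          using ne fibre_sub[OF t] by blast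
        then obtain t' where "\<And>b. t' b \<in> fibre Sg g x (?v' b) (g ((?v b)(x := sub [b] t)))"
          by metis
        from node_in_fibre[OF g v t Some this] show ?thesis by blast
      qed
    qed
    show "infinite (fibre Sg g x v' q)" if "infinite (fibre Sg g x v q)"
    proof -
      \<comment> \<open>Pigeonhole: there are finitely many keys, so infinitely many witnesses share
        one, and these embed into the product of the two child fibres given by that key. Removing
        the empty tree guarantees an actual root label.\<close>
      define key where "key t = (t [], g ((?v False)(x := sub [False] t)), g ((?v True)(x := sub [True] t))) "
        for t :: "'a ltree"
      let ?T = "fibre Sg g x v q - {Map.empty}"
      have "key ` ?T \<subseteq> (Some ` Sg) \<times> ?Q \<times> ?Q"
      proof (rule image_subsetI)
        fix t assume t: "t \<in> ?T"
        then have tree: "is_tree Sg t" by (simp add: fibre_def)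
        have "t [] \<in> Some ` Sg"
          using t root_None_iff[OF tree] is_tree_label[OF tree, of "[]"] by (cases "t []") auto
        then show "key t \<in> (Some ` Sg) \<times> ?Q \<times> ?Q"
          using tree v by (auto simp: key_def intro!: imageI vals_upd vals_sub is_tree_sub)
      qed
      then have "finite (key ` ?T)"
        by (rule finite_subset) (use Sg val_congr_finite[OF g] in simp)
      moreover have "infinite ?T" using that by simp
      ultimately obtain t where t: "t \<in> ?T" and tinf: "infinite {s \<in> ?T. key s = key t}"
        using pigeonhole_infinite by blast
      have tf: "t \<in> fibre Sg g x v q" using t by blast
      obtain a where a: "t [] = Some a"
        using t root_None_iff[of Sg t] by (cases "t []") (auto simp: fibre_def)
      define p where "p b = g ((?v b)(x := sub [b] t))" for b
      let ?P = "\<lambda>w. fibre Sg g x (w False) (p False) \<times> fibre Sg g x (w True) (p True)"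
      let ?n = "\<lambda>(t0, t1). node (Some a) t0 t1"
      have "{s \<in> ?T. key s = key t} \<subseteq> ?n ` ?P ?v"
      proof
        fix s assume s: "s \<in> {s \<in> ?T. key s = key t}"
        then have sf: "s \<in> fibre Sg g x v q" by blast
        have "s = node (Some a) (sub [False] s) (sub [True] s)"
          by (rule tree_eqI) (use s a in \<open>simp_all add: key_def\<close>)
        moreover have "(sub [False] s, sub [True] s) \<in> ?P ?v"
          using fibre_sub[OF sf, of "[False]"] fibre_sub[OF sf, of "[True]"] s by (simp add: key_def p_def)
        ultimately show "s \<in> ?n ` ?P ?v" by (metis (mono_tags, lifting) case_prod_conv imageI)
      qed
      with tinf have "infinite (?P ?v)"
        by (meson finite_imageI finite_subset)
      \<comment> \<open>A product is infinite iff both factors are nonempty and one of them is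
        infinite, so the first two components of \<open>h\<close> together transfer this to
        \<open>v'\<close>.\<close>
      then have "infinite (?P ?v')"
        unfolding finite_cartesian_product_iff using ne inf by blast
      moreover have "inj_on ?n (?P ?v')"
        by (rule inj_on_inverseI[of _ "\<lambda>s. (sub [False] s, sub [True] s)"]) auto
      ultimately have "infinite (?n ` ?P ?v')"
        using finite_imageD by blast
      moreover have "?n ` ?P ?v' \<subseteq> fibre Sg g x v' q"
      proof (rule image_subsetI, clarify)
        fix t0 t1 assume t01: "t0 \<in> fibre Sg g x (?v' False) (p False)" "t1 \<in> fibre Sg g x (?v' True) (p True)"
        have "(if b then t1 else t0) \<in> fibre Sg g x (?v' b) (g ((?v b)(x := sub [b] t)))" for b
          using t01 by (cases b) (simp_all add: p_def)
        from node_in_fibre[OF g v tf a this] show "node (Some a) t0 t1 \<in> fibre Sg g x v' q" by simp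
      qed
      ultimately show ?thesis
        using finite_subset by blast
    qed
  qed
  have "h v = h v'"
    if "v \<in> vals Sg" "v' \<in> vals Sg" "\<And>y. v y [] = v' y []"
      "\<And>b. h (\<lambda>y. sub [b] (v y)) = h (\<lambda>y. sub [b] (v' y))" for v v'
    using step[OF that] step[OF that(2,1) that(3,4)[symmetric]] unfolding h_def by blast
  with fin have "val_congr Sg h"
    unfolding val_congr_def by blast
  then show ?thesis
    unfolding h_def .
qed

lemma recognisable_Ex_ExInf:
  assumes "recognisable Sg P" "finite Sg"
  shows recognisable_Ex: "recognisable Sg (\<lambda>v. \<exists>t. is_tree Sg t \<and> P (v(x := t)))"
    and recognisable_ExInf: "recognisable Sg (\<lambda>v. infinite {t. is_tree Sg t \<and> P (v(x := t))})"
proof -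
  obtain g :: "_ \<Rightarrow> nat" and F where g: "val_congr Sg g" and F: "\<forall>v\<in>vals Sg. P v \<longleftrightarrow> g v \<in> F"
    using assms(1) unfolding recognisable_def by blast
  note congr = val_congr_fibre[OF g assms(2), of x]
  have P: "P (v(x := t)) \<longleftrightarrow> t \<in> fibre Sg g x v (g (v(x := t))) \<and> g (v(x := t)) \<in> F"
    if "v \<in> vals Sg" "is_tree Sg t" for v t
    using F that vals_upd[of v Sg t x] by (auto simp: fibre_def)
  show "recognisable Sg (\<lambda>v. \<exists>t. is_tree Sg t \<and> P (v(x := t)))"
  proof (rule recognisableI[OF congr, of _ "{(E, _). E \<inter> F \<noteq> {}}"])
    fix v assume v: "v \<in> vals Sg"
    show "(\<exists>t. is_tree Sg t \<and> P (v(x := t))) \<longleftrightarrow>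
      ({q. fibre Sg g x v q \<noteq> {}}, {q. infinite (fibre Sg g x v q)}, g (v(x := Map.empty)))
        \<in> {(E, _). E \<inter> F \<noteq> {}}"
      using P[OF v] by (auto simp: fibre_def)
  qed
  show "recognisable Sg (\<lambda>v. infinite {t. is_tree Sg t \<and> P (v(x := t))})"
  proof (rule recognisableI[OF congr, of _ "{(_, I, _). I \<inter> F \<noteq> {}}"])
    fix v assume v: "v \<in> vals Sg"
    \<comment> \<open>\<open>F\<close> may be infinite, but only values in the range of
      \<open>g\<close> occur; a union over a finite index set is infinite iff some member
      is.\<close>
    have "{t. is_tree Sg t \<and> P (v(x := t))} = (\<Union>q\<in>F \<inter> g ` vals Sg. fibre Sg g x v q)"
      using P[OF v] v by (auto simp: fibre_def intro!: imageI vals_upd)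
    moreover have "finite (F \<inter> g ` vals Sg)"
      using val_congr_finite[OF g] by blast
    ultimately have "infinite {t. is_tree Sg t \<and> P (v(x := t))} \<longleftrightarrow>
        (\<exists>q\<in>F \<inter> g ` vals Sg. infinite (fibre Sg g x v q))"
      by simp
    moreover have "q \<in> g ` vals Sg" if "infinite (fibre Sg g x v q)" for q
    proof -
      obtain t where "t \<in> fibre Sg g x v q" using infinite_imp_nonempty[OF \<open>infinite _\<close>] by blast
      then show ?thesis using v by (auto simp: fibre_def intro!: imageI vals_upd)
    qed
    ultimately show "infinite {t. is_tree Sg t \<and> P (v(x := t))} \<longleftrightarrow>
      ({q. fibre Sg g x v q \<noteq> {}}, {q. infinite (fibre Sg g x v q)}, g (v(x := Map.empty)))
        \<in> {(_, I, _). I \<inter> F \<noteq> {}}"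
      by blast
  qed
qed

text \<open>Each label lists the labels of all components, and a missing label means that all are
  undefined there. The length has to be known, since all lists of empty trees have the same
  convolution.\<close>

lemma conv_inj:
  assumes "conv ts = conv ts'" "length ts = length ts'"
  shows "ts = ts'"
proof (rule nth_equalityI[OF assms(2)], rule ext)
  fix i u assume i: "i < length ts"
  have nth: "(ts ! i) u = (case conv ts u of None \<Rightarrow> None | Some l \<Rightarrow> l ! i)" if "i < length ts" for ts :: "'a ltree list" and i
    using that nth_mem[OF that] by (fastforce simp: conv_def domIff)
  show "(ts ! i) u = (ts' ! i) u"
    using nth[of i ts] nth[of i ts'] i assms by simp
qed

text \<open>The way back from valuations to automata on convolutions. The congruence must be defined
  on all trees over the convolution alphabet and must detect those that are not convolutions; by
  \<open>conv_inj\<close> a decoding is unique.\<close>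

lemma conv_regular:
  assumes h: "val_congr Sg h"
  shows "\<exists>M. wf_aut (conv_alph Sg r) M \<and> lang (conv_alph Sg r) M =
    {conv ts | ts. length ts = r \<and> (\<forall>t\<in>set ts. is_tree Sg t) \<and>
       h (\<lambda>i. if i < r then ts ! i else Map.empty) \<in> F}"
proof -
  let ?A = "conv_alph Sg r"
  let ?v = "\<lambda>ts i. if i < r then ts ! i else Map.empty"
  define dec where "dec T ts \<longleftrightarrow> length ts = r \<and> (\<forall>t\<in>set ts. is_tree Sg t) \<and> conv ts = T" for T ts
  \<comment> \<open>The empty components are recorded as well: a component without label at the root
    may only have empty children, so this decides whether decoded children combine to trees.\<close>
  define f where "f ts = (h (?v ts), map (\<lambda>t. t = Map.empty) ts)" for ts
  \<comment> \<open>A singleton if \<open>T\<close> is a convolution of \<open>r\<close> trees, and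
    the empty set otherwise, which acts as a rejecting sink.\<close>
  define g where "g T = f ` {ts. dec T ts}" for T
  have gdec: "g T = {f ts}" if "dec T ts" for T ts
  proof -
    have "us = ts" if "dec T us" for us
      using that \<open>dec T ts\<close> conv_inj[of us ts] by (simp add: dec_def)
    then have "{ts. dec T ts} = {ts}" using that by blast
    then show ?thesis by (simp add: g_def)
  qed
  have gempty: "g T = {}" if "\<nexists>ts. dec T ts" for T
    using that by (simp add: g_def)
  have v: "?v ts \<in> vals Sg" if "dec T ts" for T ts
    using that by (simp add: dec_def vals_def)
  have dsub: "dec (sub u T) (map (sub u) ts)" if "dec T ts" for u T ts
    using that by (auto simp: dec_def sub_conv is_tree_sub)
  have vsub: "?v (map (sub u) ts) = (\<lambda>i. sub u (?v ts i))" if "dec T ts" for u T ts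
    using that by (auto simp: dec_def)
  have fin: "finite (g ` {T. is_tree ?A T})"
  proof (rule finite_subset)
    let ?B = "h ` vals Sg \<times> {bs. set bs \<subseteq> (UNIV :: bool set) \<and> length bs = r}"
    show "g ` {T. is_tree ?A T} \<subseteq> insert {} ((\<lambda>y. {y}) ` ?B)"
    proof (rule image_subsetI)
      fix T
      show "g T \<in> insert {} ((\<lambda>y. {y}) ` ?B)"
      proof (cases "\<exists>ts. dec T ts")
        case True
        then obtain ts where ts: "dec T ts" ..
        have "f ts \<in> ?B"
          using v[OF ts] ts by (auto simp: f_def dec_def)
        then show ?thesis unfolding gdec[OF ts] by blast
      qed (simp add: gempty)
    qed
    show "finite (insert {} ((\<lambda>y. {y}) ` ?B))"
      using val_congr_finite[OF h] finite_lists_length_eq[of "UNIV :: bool set" r] by simp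
  qed
  \<comment> \<open>Decodability passes from \<open>T\<close> to \<open>T'\<close>: the entries of
    the common root label are placed on top of the decodings of the two children of
    \<open>T'\<close>.\<close>
  have step: "g T' = g T"
    if T: "is_tree ?A T" "is_tree ?A T'" "T [] = T' []" and eq: "\<And>b. g (sub [b] T) = g (sub [b] T')"
      and ts: "dec T ts" for T T' ts
  proof (cases "T []")
    case None
    then have "T = T'"
      using T(3) root_None_iff[OF T(1)] root_None_iff[OF T(2)] by simp
    then show ?thesis by simp
  next
    case (Some l)
    have l: "l = map (\<lambda>t. t []) ts" "\<exists>t\<in>set ts. t [] \<noteq> None"
      using Some ts by (auto simp: dec_def conv_root split: if_splits)
    have "\<exists>us. dec (sub [b] T') us \<and> f us = f (map (sub [b]) ts)" for b
    proof -
      have "g (sub [b] T') = {f (map (sub [b]) ts)}"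
        using eq gdec[OF dsub[OF ts]] by metis
      then have "f (map (sub [b]) ts) \<in> f ` {ts. dec (sub [b] T') ts}"
        unfolding g_def by blast
      then show ?thesis by auto
    qed
    then obtain us where us: "\<And>b. dec (sub [b] T') (us b)" "\<And>b. f (us b) = f (map (sub [b]) ts)"
      by metis
    have len: "length ts = r" "\<And>b. length (us b) = r"
      using ts us(1) by (auto simp: dec_def)
    have tree: "is_tree Sg (ts ! i)" "is_tree Sg (us b ! i)" if "i < r" for i b
      using ts us(1)[of b] that by (auto simp: dec_def)
    have emp: "us b ! i = Map.empty \<longleftrightarrow> sub [b] (ts ! i) = Map.empty" if "i < r" for b i
    proof -
      have "map (\<lambda>t. t = Map.empty) (us b) ! i = map (\<lambda>t. t = Map.empty) (map (sub [b]) ts) ! i"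
        using us(2)[of b] by (simp only: f_def prod.inject)
      then show ?thesis using that len by simp
    qed
    define ts' where "ts' = map (\<lambda>i. node (l ! i) (us False ! i) (us True ! i)) [0..<r]"
    have len': "length ts' = r" by (simp add: ts'_def)
    have nth': "ts' ! i = node (l ! i) (us False ! i) (us True ! i)" if "i < r" for i
      using that by (simp add: ts'_def)
    have root: "map (\<lambda>t. t []) ts' = l"
      using l(1) len by (intro nth_equalityI) (auto simp: len' nth')
    have subts': "map (sub [b]) ts' = us b" for b
      using len by (intro nth_equalityI) (auto simp: len' nth')
    have tree': "is_tree Sg (ts' ! i)" if "i < r" for i
    proof -
      have li: "l ! i = (ts ! i) []" using that l(1) len by simp
      show ?thesis
        unfolding nth'[OF that]
      proof (rule is_tree_node)
        show "a \<in> Sg" if "l ! i = Some a" for a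
          using is_tree_label[OF tree(1)[OF \<open>i < r\<close>]] that li by metis
        assume "l ! i = None"
        then have "ts ! i = Map.empty"
          using root_None_iff[OF tree(1)[OF \<open>i < r\<close>]] li by simp
        then show "us False ! i = Map.empty \<and> us True ! i = Map.empty"
          using emp[OF \<open>i < r\<close>] by simp
      qed (use tree that in auto)
    qed
    have conv': "conv ts' = T'"
    proof (rule tree_eqI)
      have "\<exists>t\<in>set ts'. t [] \<noteq> None"
      proof -
        have "\<exists>x\<in>set l. x \<noteq> None" using l by auto
        then show ?thesis unfolding root[symmetric] by auto
      qed
      then show "conv ts' [] = T' []"
        using root Some T(3) by (simp add: conv_root)
      show "sub [b] (conv ts') = sub [b] T'" for b
        using us(1)[of b] unfolding sub_conv subts' dec_def by blast
    qed
    have ts': "dec T' ts'"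
      using tree' conv' len' by (auto simp: dec_def in_set_conv_nth)
    have "h (?v ts') = h (?v ts)"
    proof (rule val_congrD[OF h v[OF ts'] v[OF ts]])
      show "?v ts' i [] = ?v ts i []" for i
        using nth' l(1) len by simp
      show "h (\<lambda>i. sub [b] (?v ts' i)) = h (\<lambda>i. sub [b] (?v ts i))" for b
        using us(2)[of b] unfolding vsub[OF ts, symmetric] vsub[OF ts', symmetric] subts'
        by (simp only: f_def prod.inject)
    qed
    moreover have "ts' ! i = Map.empty \<longleftrightarrow> ts ! i = Map.empty" if "i < r" for i
      using root_None_iff[OF tree'[OF that]] root_None_iff[OF tree(1)[OF that]] nth'[OF that] l(1) len that
      by simp
    then have "map (\<lambda>t. t = Map.empty) ts' = map (\<lambda>t. t = Map.empty) ts"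
      using len len' by (intro nth_equalityI) auto
    ultimately have "f ts' = f ts"
      unfolding f_def by (simp only: prod.inject)
    then show ?thesis
      using gdec[OF ts] gdec[OF ts'] by simp
  qed
  have "g T = g T'"
    if "is_tree ?A T" "is_tree ?A T'" "T [] = T' []" "\<And>b. g (sub [b] T) = g (sub [b] T')" for T T'
  proof (cases "(\<exists>ts. dec T ts) \<or> (\<exists>ts. dec T' ts)")
    case True
    then show ?thesis
      using step[OF that] step[OF that(2,1) that(3,4)[symmetric]] by blast
  next
    case False
    then have "g T = {}" "g T' = {}" using gempty by blast+
    then show ?thesis by simp
  qed
  with fin have "tree_congr ?A g"
    unfolding tree_congr_def by blast
  \<comment> \<open>Accepting are the singletons with first entry in \<open>F\<close>; the empty
    set, hence every tree that is not a convolution, is rejected.\<close>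
  from tree_congr_regular[OF this, of "{X. \<exists>q bs. X = {(q, bs)} \<and> q \<in> F}"] obtain M
    where M: "wf_aut ?A M" "lang ?A M = {T. is_tree ?A T \<and> g T \<in> {X. \<exists>q bs. X = {(q, bs)} \<and> q \<in> F}}"
    by blast
  have "is_tree ?A T \<and> g T \<in> {X. \<exists>q bs. X = {(q, bs)} \<and> q \<in> F} \<longleftrightarrow> (\<exists>ts. dec T ts \<and> h (?v ts) \<in> F)" for T
  proof (cases "\<exists>ts. dec T ts")
    case True
    then obtain ts where ts: "dec T ts" ..
    have tree: "is_tree ?A T"
      using ts is_tree_conv[of ts Sg r] by (auto simp: dec_def)
    have gF: "g T \<in> {X. \<exists>q bs. X = {(q, bs)} \<and> q \<in> F} \<longleftrightarrow> h (?v ts) \<in> F"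
      unfolding gdec[OF ts] f_def by simp
    show ?thesis
    proof
      assume "is_tree ?A T \<and> g T \<in> {X. \<exists>q bs. X = {(q, bs)} \<and> q \<in> F}"
      with gF ts show "\<exists>ts. dec T ts \<and> h (?v ts) \<in> F" by blast
    next
      assume "\<exists>ts. dec T ts \<and> h (?v ts) \<in> F"
      then obtain us where us: "dec T us" "h (?v us) \<in> F" by blast
      have "us = ts"
        using us(1) ts conv_inj[of us ts] by (simp add: dec_def)
      with us(2) gF tree show "is_tree ?A T \<and> g T \<in> {X. \<exists>q bs. X = {(q, bs)} \<and> q \<in> F}"
        by blast
    qed
  next
    case False
    then show ?thesis using gempty[OF False] by auto
  qed
  then have "lang ?A M = {conv ts | ts. length ts = r \<and> (\<forall>t\<in>set ts. is_tree Sg t) \<and> h (?v ts) \<in> F}"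
    unfolding M(2) by (auto simp: dec_def)
  with M(1) show ?thesis by blast
qed

section \<open>Cutting trees along a finite domain\<close>

text \<open>For a tree domain \<open>D\<close> these are the minimal nodes outside it. The clause
  \<open>u = []\<close> covers an empty \<open>D\<close>, whose only boundary node is the root; this
  happens when there are no parameters.\<close>

definition boundary :: "bool list set \<Rightarrow> bool list set" where
  "boundary D = {u. u \<notin> D \<and> (u = [] \<or> butlast u \<in> D)}"

lemma finite_boundary:
  assumes "finite D"
  shows "finite (boundary D)"
proof (rule finite_subset)
  show "boundary D \<subseteq> insert [] ((\<lambda>(u, b). u @ [b]) ` (D \<times> UNIV))"
  proof
    fix u assume u: "u \<in> boundary D"
    show "u \<in> insert [] ((\<lambda>(u, b). u @ [b]) ` (D \<times> UNIV))"
    proof (cases u rule: rev_cases)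
      case (snoc w b)
      then have "(w, b) \<in> D \<times> UNIV" using u by (simp add: boundary_def)
      then show ?thesis unfolding snoc by (metis (no_types, lifting) case_prod_conv image_eqI insertCI)
    qed simp
  qed
  show "finite (insert [] ((\<lambda>(u, b). u @ [b]) ` (D \<times> (UNIV :: bool set))))"
    using assms by simp
qed

lemma root_in_boundary: "[] \<in> D \<union> boundary D"
  by (simp add: boundary_def)

lemma child_in_boundary: "u \<in> D \<Longrightarrow> u @ [b] \<in> D \<union> boundary D"
  by (simp add: boundary_def)

text \<open>Below a boundary node one never returns to \<open>D\<close>, so boundary nodes are
  pairwise incomparable and the subtrees at them can be exchanged independently.\<close>

lemma boundary_extend:
  assumes "tree_dom D" "u \<in> boundary D"
  shows "u @ w \<notin> D" and "u @ w \<in> boundary D \<Longrightarrow> w = []"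
proof -
  show "u @ w \<notin> D" for w
    using assms unfolding tree_dom_def boundary_def by blast
  from this[of "butlast w"] show "u @ w \<in> boundary D \<Longrightarrow> w = []"
    by (auto simp: boundary_def butlast_append split: if_splits)
qed

text \<open>Bottom-up induction: both children of a node of \<open>D\<close> lie in \<open>D\<close>
  or on its boundary, and \<open>D\<close> has bounded depth.\<close>

lemma boundary_induct [consumes 2, case_names boundary inner]:
  assumes "finite D" "u \<in> D \<union> boundary D"
    and "\<And>u. u \<in> boundary D \<Longrightarrow> P u"
    and "\<And>u. u \<in> D \<Longrightarrow> (\<And>b. P (u @ [b])) \<Longrightarrow> P u"
  shows "P u"
proof -
  obtain N where N: "\<And>w. w \<in> D \<Longrightarrow> length w \<le> N"
    using finite_maxlen[OF assms(1)] less_imp_le by metis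
  show ?thesis
    using assms(2)
  \<comment> \<open>The extra 1 keeps the truncated subtraction strictly decreasing even from a node
    of length \<open>N\<close>.\<close>
  proof (induction "N + 1 - length u" arbitrary: u rule: less_induct)
    case less
    show ?case
    proof (cases "u \<in> D")
      case True
      have "P (u @ [b])" for b
      proof (rule less.hyps)
        show "N + 1 - length (u @ [b]) < N + 1 - length u"
          using N[OF True] by simp
      qed (rule child_in_boundary[OF True])
      then show ?thesis by (rule assms(4)[OF True])
    next
      case False
      then show ?thesis using less.prems assms(3) by blast
    qed
  qed
qed

text \<open>The composition principle: going up from the boundary, whatever lies below
  \<open>D\<close> enters only through its value there. It is applied to the relation automata, to
  the automaton of the universe and to the formula.\<close>

lemma val_congr_boundary:
  assumes h: "val_congr Sg h" and D: "finite D" and v: "v \<in> vals Sg" "v' \<in> vals Sg"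
    and inner: "\<And>x w. w \<in> D \<Longrightarrow> v x w = v' x w"
    and outer: "\<And>u. u \<in> boundary D \<Longrightarrow> h (\<lambda>x. sub u (v x)) = h (\<lambda>x. sub u (v' x))"
  shows "h v = h v'"
proof -
  have "h (\<lambda>x. sub u (v x)) = h (\<lambda>x. sub u (v' x))" if "u \<in> D \<union> boundary D" for u
    using D that
  proof (induction rule: boundary_induct)
    case (boundary u)
    then show ?case by (rule outer)
  next
    case (inner u)
    show ?case
      by (rule val_congrD[OF h vals_sub[OF v(1)] vals_sub[OF v(2)]])
        (use inner assms(5) in simp_all)
  qed
  from this[OF root_in_boundary] show ?thesis by simp
qed

lemma tree_eq_boundary:
  assumes "finite D" "\<And>w. w \<in> D \<Longrightarrow> t w = t' w" "\<And>u. u \<in> boundary D \<Longrightarrow> sub u t = sub u t'"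
  shows "t = t'"
proof -
  have "sub u t = sub u t'" if "u \<in> D \<union> boundary D" for u
    using assms(1) that
  proof (induction rule: boundary_induct)
    case (inner u)
    show ?case
      by (rule tree_eqI) (use inner assms(2) in simp_all)
  qed (rule assms(3))
  from this[OF root_in_boundary] show ?thesis by simp
qed

text \<open>The existence counterpart of \<open>tree_eq_boundary\<close>; together they turn
  boundary subtrees into independent coordinates. Nothing can hang below a missing node, so the new
  subtrees have to be empty where the old ones are.\<close>

lemma graft_exists:
  assumes D: "tree_dom D" and t: "is_tree Sg t"
    and s: "\<And>u. u \<in> boundary D \<Longrightarrow> is_tree Sg (s u)"
      "\<And>u. u \<in> boundary D \<Longrightarrow> s u = Map.empty \<longleftrightarrow> sub u t = Map.empty"
  shows "\<exists>t'. is_tree Sg t' \<and> (\<forall>w\<in>D. t' w = t w) \<and> (\<forall>u\<in>boundary D. sub u t' = s u)"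
proof -
  have fin: "finite D" using D by (simp add: tree_dom_def)
  \<comment> \<open>The emptiness equivalence belongs to the induction claim: where \<open>t\<close>
    has no label at \<open>u\<close>, it forces both grafted children to be empty.\<close>
  have "\<exists>t'. is_tree Sg t' \<and> (t' = Map.empty \<longleftrightarrow> sub u t = Map.empty) \<and>
      (\<forall>w. u @ w \<in> D \<longrightarrow> t' w = t (u @ w)) \<and> (\<forall>w. u @ w \<in> boundary D \<longrightarrow> sub w t' = s (u @ w))"
    if "u \<in> D \<union> boundary D" for u
    using fin that
  proof (induction rule: boundary_induct)
    case (boundary u)
    have "sub w (s u) = s (u @ w)" if "u @ w \<in> boundary D" for w
      using boundary_extend(2)[OF D boundary that] by simp
    then show ?case
      using s[OF boundary] boundary_extend(1)[OF D boundary] by (intro exI[of _ "s u"]) blast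
  next
    case (inner u)
    then obtain t' where t': "\<And>b. is_tree Sg (t' b)"
      "\<And>b. t' b = Map.empty \<longleftrightarrow> sub (u @ [b]) t = Map.empty"
      "\<And>b w. u @ b # w \<in> D \<Longrightarrow> t' b w = t (u @ b # w)"
      "\<And>b w. u @ b # w \<in> boundary D \<Longrightarrow> sub w (t' b) = s (u @ b # w)"
      by (simp add: choice_iff) metis
    let ?t = "node (t u) (t' False) (t' True)"
    have sub: "sub (b # w) ?t = sub w (t' b)" for b w
      by (cases b) (simp_all add: sub_def)
    have tree: "is_tree Sg ?t"
    proof (rule is_tree_node)
      assume None: "t u = None"
      have "sub (u @ [b]) t = Map.empty" for b
        by (rule sub_outside[OF t]) (rule is_tree_prefix[OF t None])
      then show "t' False = Map.empty \<and> t' True = Map.empty"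
        using t'(2) by blast
    qed (use t'(1) is_tree_label[OF t] in auto)
    moreover have "?t = Map.empty \<longleftrightarrow> sub u t = Map.empty"
      using root_None_iff[OF tree] root_None_iff[OF is_tree_sub[OF t], of u] by simp
    moreover have "?t w = t (u @ w)" if "u @ w \<in> D" for w
      using that t'(3) by (cases w) auto
    moreover have "sub w ?t = s (u @ w)" if "u @ w \<in> boundary D" for w
    proof (cases w)
      case Nil
      then show ?thesis using that inner(1) by (simp add: boundary_def)
    next
      case (Cons b w')
      then show ?thesis using that t'(4)[of b w'] by (simp only: sub)
    qed
    ultimately show ?case by blast
  qed
  from this[OF root_in_boundary] show ?thesis by auto
qed

text \<open>Each colour class then lies inside the relation or is disjoint from it, which is the
  form in which run states provide colourings.\<close>

lemma colouringI:
  assumes "finite (c ` tuples (uni B) (ar R))"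
    and "\<And>t t'. t \<in> tuples (uni B) (ar R) \<Longrightarrow> t' \<in> tuples (uni B) (ar R) \<Longrightarrow> c t = c t' \<Longrightarrow>
       t' \<in> rels B R \<Longrightarrow> t \<in> rels B R"
  shows "colouring ar B R c"
  unfolding colouring_def using assms by blast

lemma restrict_restrict: "K \<subseteq> X \<Longrightarrow> restrict (restrict A X) K = restrict A K"
  by (auto simp: restrict_def fun_eq_iff)

lemma struc_of_restrict: "struc_of Tau ar A \<Longrightarrow> struc_of Tau ar (restrict A K)"
  by (auto simp: struc_of_def restrict_def tuples_def)

section \<open>Definable sets in a tree-automatic structure\<close>

locale tree_presentation =
  fixes Tau :: "'r set" and ar :: "'r \<Rightarrow> nat" and A :: "('a, 'r) struc"
    and Sg :: "nat set" and M :: "nat aut" and MR :: "'r \<Rightarrow> nat option list aut"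
    and \<mu> :: "'a \<Rightarrow> nat ltree"
  assumes sig: "signature Tau ar"
    and struc: "struc_of Tau ar A"
    and finite_Sg: "finite Sg"
    and wf_M: "wf_aut Sg M"
    and bij: "bij_betw \<mu> (uni A) (lang Sg M)"
    and wf_MR: "\<And>R. R \<in> Tau \<Longrightarrow> wf_aut (conv_alph Sg (ar R)) (MR R)"
    and lang_MR: "\<And>R. R \<in> Tau \<Longrightarrow> lang (conv_alph Sg (ar R)) (MR R) = (\<lambda>xs. conv (map \<mu> xs)) ` rels A R"
begin

section \<open>Relations and formulas seen through the presentation\<close>

abbreviation trees :: "nat ltree set" where
  "trees \<equiv> {t. is_tree Sg t}"

lemma mu_in_lang: "a \<in> uni A \<Longrightarrow> \<mu> a \<in> lang Sg M"
  using bij by (auto simp: bij_betw_def)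

lemma mu_tree: "a \<in> uni A \<Longrightarrow> is_tree Sg (\<mu> a)"
  using mu_in_lang by (auto simp: lang_def)

lemma mu_inj: "inj_on \<mu> (uni A)"
  using bij by (auto simp: bij_betw_def)

lemma mu_surj: "t \<in> lang Sg M \<Longrightarrow> \<exists>a\<in>uni A. \<mu> a = t"
  using bij by (force simp: bij_betw_def)

text \<open>Membership can be read back from the automaton because \<open>conv\<close> is injective
  on lists of equal length and \<open>\<mu>\<close> is injective on the universe.\<close>

lemma rel_iff:
  assumes "R \<in> Tau" "xs \<in> tuples (uni A) (ar R)"
  shows "xs \<in> rels A R \<longleftrightarrow> conv (map \<mu> xs) \<in> lang (conv_alph Sg (ar R)) (MR R)"
proof
  assume "conv (map \<mu> xs) \<in> lang (conv_alph Sg (ar R)) (MR R)"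
  then obtain ys where ys: "ys \<in> rels A R" "conv (map \<mu> xs) = conv (map \<mu> ys)"
    using lang_MR[OF assms(1)] by auto
  have yt: "ys \<in> tuples (uni A) (ar R)"
    using struc ys(1) assms(1) by (auto simp: struc_of_def)
  have "map \<mu> xs = map \<mu> ys"
    by (rule conv_inj[OF ys(2)]) (use yt assms(2) in \<open>simp add: tuples_def\<close>)
  moreover have "inj_on \<mu> (set xs \<union> set ys)"
    by (rule inj_on_subset[OF mu_inj]) (use yt assms(2) in \<open>auto simp: tuples_def\<close>)
  ultimately have "xs = ys" by (rule map_inj_on)
  with ys(1) show "xs \<in> rels A R" by simp
qed (use lang_MR[OF assms(1)] in auto)

text \<open>By induction on the formula. \<open>P\<close> speaks about arbitrary trees, so the
  quantifiers of \<open>A\<close> become quantifiers over trees relativised to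
  \<open>lang Sg M\<close>.\<close>

lemma sat_recognisable:
  assumes "fo_over Tau ar phi"
  shows "\<exists>P. recognisable Sg P \<and> (\<forall>v. range v \<subseteq> uni A \<longrightarrow> (sat A v phi \<longleftrightarrow> P (\<lambda>x. \<mu> (v x))))"
  using assms
proof (induction phi)
  case (Rel R xs)
  then have R: "R \<in> Tau" and len: "length xs = ar R" by auto
  let ?P = "\<lambda>v. conv (map v xs) \<in> lang (conv_alph Sg (length xs)) (MR R)"
  have "recognisable Sg ?P"
    by (rule recognisable_conv) (use wf_MR[OF R] len in simp)
  moreover have "sat A v (Rel R xs) \<longleftrightarrow> ?P (\<lambda>x. \<mu> (v x))" if "range v \<subseteq> uni A" for v
    using rel_iff[OF R, of "map v xs"] that len by (auto simp: tuples_def comp_def)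
  ultimately show ?case by blast
next
  case (Eq x y)
  have "sat A v (Eq x y) \<longleftrightarrow> \<mu> (v x) = \<mu> (v y)" if "range v \<subseteq> uni A" for v
    using that inj_onD[OF mu_inj] by (auto simp: range_subsetD)
  then show ?case using recognisable_eq[of Sg x y] by (intro exI[of _ "\<lambda>v. v x = v y"]) blast
next
  case (Neg p)
  then obtain P where "recognisable Sg P" "\<forall>v. range v \<subseteq> uni A \<longrightarrow> (sat A v p \<longleftrightarrow> P (\<lambda>x. \<mu> (v x)))"
    by auto
  then show ?case
    using recognisable_Not[of Sg P] by (intro exI[of _ "\<lambda>v. \<not> P v"]) simp
next
  case (Conj p q)
  then obtain P Q where "recognisable Sg P" "\<forall>v. range v \<subseteq> uni A \<longrightarrow> (sat A v p \<longleftrightarrow> P (\<lambda>x. \<mu> (v x)))"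
    "recognisable Sg Q" "\<forall>v. range v \<subseteq> uni A \<longrightarrow> (sat A v q \<longleftrightarrow> Q (\<lambda>x. \<mu> (v x)))"
    by auto
  then show ?case
    using recognisable_conj[of Sg P Q] by (intro exI[of _ "\<lambda>v. P v \<and> Q v"]) simp
next
  case (Ex x p)
  then obtain P where P: "recognisable Sg P" "\<forall>v. range v \<subseteq> uni A \<longrightarrow> (sat A v p \<longleftrightarrow> P (\<lambda>x. \<mu> (v x)))"
    by auto
  let ?Q = "\<lambda>v. P v \<and> v x \<in> lang Sg M"
  let ?P = "\<lambda>v. \<exists>t. is_tree Sg t \<and> ?Q (v(x := t))"
  have "recognisable Sg ?P"
    by (intro recognisable_Ex recognisable_conj recognisable_lang P wf_M finite_Sg)
  moreover have "sat A v (Ex x p) \<longleftrightarrow> ?P (\<lambda>x. \<mu> (v x))" if v: "range v \<subseteq> uni A" for v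
  proof -
    have iff: "sat A (v(x := a)) p \<longleftrightarrow> P ((\<lambda>x. \<mu> (v x))(x := \<mu> a))" if "a \<in> uni A" for a
    proof -
      have "range (v(x := a)) \<subseteq> uni A" using v that by auto
      moreover have "(\<lambda>y. \<mu> ((v(x := a)) y)) = (\<lambda>x. \<mu> (v x))(x := \<mu> a)" by auto
      ultimately show ?thesis using P(2) by metis
    qed
    show ?thesis
      using iff mu_tree mu_in_lang mu_surj by (simp only: sat.simps fun_upd_same) metis
  qed
  ultimately show ?case by blast
next
  case (ExInf x p)
  then obtain P where P: "recognisable Sg P" "\<forall>v. range v \<subseteq> uni A \<longrightarrow> (sat A v p \<longleftrightarrow> P (\<lambda>x. \<mu> (v x)))"
    by auto
  let ?Q = "\<lambda>v. P v \<and> v x \<in> lang Sg M"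
  let ?P = "\<lambda>v. infinite {t. is_tree Sg t \<and> ?Q (v(x := t))}"
  have "recognisable Sg ?P"
    by (intro recognisable_ExInf recognisable_conj recognisable_lang P wf_M finite_Sg)
  moreover have "sat A v (ExInf x p) \<longleftrightarrow> ?P (\<lambda>x. \<mu> (v x))" if v: "range v \<subseteq> uni A" for v
  proof -
    have iff: "sat A (v(x := a)) p \<longleftrightarrow> P ((\<lambda>x. \<mu> (v x))(x := \<mu> a))" if "a \<in> uni A" for a
    proof -
      have "range (v(x := a)) \<subseteq> uni A" using v that by auto
      moreover have "(\<lambda>y. \<mu> ((v(x := a)) y)) = (\<lambda>x. \<mu> (v x))(x := \<mu> a)" by auto
      ultimately show ?thesis using P(2) by metis
    qed
    \<comment> \<open>Witnesses in \<open>A\<close> correspond bijectively to tree witnesses, so the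
      two sets are infinite together.\<close>
    have "{t. is_tree Sg t \<and> ?Q ((\<lambda>x. \<mu> (v x))(x := t))} = \<mu> ` {a \<in> uni A. sat A (v(x := a)) p}"
      (is "?L = ?R")
    proof
      show "?L \<subseteq> ?R"
        using iff mu_surj by (auto simp: image_iff) metis
      show "?R \<subseteq> ?L"
        using iff mu_in_lang mu_tree by auto
    qed
    moreover have "inj_on \<mu> {a \<in> uni A. sat A (v(x := a)) p}"
      by (rule inj_on_subset[OF mu_inj]) auto
    ultimately show ?thesis
      by (simp add: finite_image_iff)
  qed
  ultimately show ?case by blast
qed

section \<open>Factor structures on trees of one type\<close>

definition enc :: "nat ltree \<Rightarrow> nat" where
  "enc = to_nat_on trees"

definition dec :: "nat \<Rightarrow> nat ltree" where
  "dec = from_nat_into trees"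

lemma dec_enc [simp]: "is_tree Sg t \<Longrightarrow> dec (enc t) = t"
  by (simp add: enc_def dec_def countable_trees)

definition factor_dom :: "(nat ltree \<Rightarrow> 'q) \<Rightarrow> 'q \<Rightarrow> nat ltree set" where
  "factor_dom \<kappa> \<sigma> = {t. is_tree Sg t \<and> \<kappa> t = \<sigma>}"

text \<open>\<open>P R\<close> takes the place of the final states of \<open>MR R\<close>: it is
  meant to hold the states that lead to acceptance once the surrounding tree is fixed.\<close>

definition factor :: "(nat ltree \<Rightarrow> 'q) \<Rightarrow> 'q \<Rightarrow> ('r \<Rightarrow> nat set) \<Rightarrow> (nat, 'r) struc" where
  "factor \<kappa> \<sigma> P = \<lparr>uni = enc ` factor_dom \<kappa> \<sigma>,
     rels = (\<lambda>R. if R \<in> Tau then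
       map enc ` {ts \<in> tuples (factor_dom \<kappa> \<sigma>) (ar R). run_state (MR R) (conv ts) \<in> P R} else {})\<rparr>"

lemma struc_of_factor: "struc_of Tau ar (factor \<kappa> \<sigma> P)"
  by (auto simp: struc_of_def factor_def tuples_def intro!: imageI)

lemma map_dec_enc: "set ts \<subseteq> factor_dom \<kappa> \<sigma> \<Longrightarrow> map dec (map enc ts) = ts"
  by (induction ts) (auto simp: factor_dom_def)

lemma tuples_factor:
  assumes "bs \<in> tuples (uni (factor \<kappa> \<sigma> P)) r"
  shows "map dec bs \<in> tuples (factor_dom \<kappa> \<sigma>) r" and "map enc (map dec bs) = bs"
proof -
  have "dec b \<in> factor_dom \<kappa> \<sigma> \<and> enc (dec b) = b" if "b \<in> set bs" for b
    using that assms by (auto simp: tuples_def factor_def factor_dom_def)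
  then show "map dec bs \<in> tuples (factor_dom \<kappa> \<sigma>) r" "map enc (map dec bs) = bs"
    using assms by (auto simp: tuples_def intro!: map_idI)
qed

lemma rels_factor:
  assumes "R \<in> Tau" "bs \<in> tuples (uni (factor \<kappa> \<sigma> P)) (ar R)"
  shows "bs \<in> rels (factor \<kappa> \<sigma> P) R \<longleftrightarrow> run_state (MR R) (conv (map dec bs)) \<in> P R"
proof
  assume "bs \<in> rels (factor \<kappa> \<sigma> P) R"
  then obtain ts where "ts \<in> tuples (factor_dom \<kappa> \<sigma>) (ar R)" "run_state (MR R) (conv ts) \<in> P R" "bs = map enc ts"
    using assms(1) by (auto simp: factor_def)
  moreover from this have "map dec bs = ts"
    using map_dec_enc[of ts \<kappa> \<sigma>] by (simp add: tuples_def)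
  ultimately show "run_state (MR R) (conv (map dec bs)) \<in> P R" by simp
next
  assume "run_state (MR R) (conv (map dec bs)) \<in> P R"
  then have "map enc (map dec bs) \<in> rels (factor \<kappa> \<sigma> P) R"
    using assms(1) tuples_factor(1)[OF assms(2)] unfolding factor_def
    by (simp only: struc.simps if_True) blast
  then show "bs \<in> rels (factor \<kappa> \<sigma> P) R"
    unfolding tuples_factor(2)[OF assms(2)] .
qed

text \<open>The presentation is \<open>dec\<close>. Its domain is a class of
  \<open>\<kappa>\<close>; for a relation, \<open>MR R\<close> is run on the convolution in parallel
  with \<open>\<kappa>\<close> on every component, and \<open>conv_regular\<close> turns this into
  an automaton.\<close>

lemma tree_automatic_factor:
  assumes \<kappa>: "tree_congr Sg \<kappa>"
  shows "tree_automatic Tau ar (factor \<kappa> \<sigma> P)"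
proof -
  obtain N where N: "wf_aut Sg N" "lang Sg N = factor_dom \<kappa> \<sigma>"
    using tree_congr_regular[OF \<kappa>, of "{\<sigma>}"] by (auto simp: factor_dom_def)
  have "\<exists>M'. wf_aut (conv_alph Sg (ar R)) M' \<and>
      lang (conv_alph Sg (ar R)) M' = (\<lambda>xs. conv (map dec xs)) ` rels (factor \<kappa> \<sigma> P) R"
    if R: "R \<in> Tau" for R
  proof -
    let ?r = "ar R"
    let ?h = "\<lambda>v. (run_state (MR R) (conv (map v [0..<?r])), \<lambda>i. if i \<in> {..<?r} then \<kappa> (v i) else undefined)"
    have "val_congr Sg (\<lambda>v. run_state (MR R) (conv (map v [0..<?r])))"
      by (rule val_congr_conv) (use wf_MR[OF R] in \<open>simp add: tree_congr_run_state\<close>)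
    moreover have "val_congr Sg (\<lambda>v i. if i \<in> {..<?r} then \<kappa> (v i) else undefined)"
      by (rule val_congr_family) (auto intro: val_congr_component[OF \<kappa>])
    ultimately have h: "val_congr Sg ?h"
      by (rule val_congr_Pair)
    let ?F = "{(q, f). q \<in> P R \<and> (\<forall>i<?r. f i = \<sigma>)}"
    obtain M' where M': "wf_aut (conv_alph Sg ?r) M'" "lang (conv_alph Sg ?r) M' =
      {conv ts | ts. length ts = ?r \<and> (\<forall>t\<in>set ts. is_tree Sg t) \<and>
       ?h (\<lambda>i. if i < ?r then ts ! i else Map.empty) \<in> ?F}"
      using conv_regular[OF h, of ?r ?F] by blast
    have h_iff: "?h (\<lambda>i. if i < ?r then ts ! i else Map.empty) \<in> ?F \<longleftrightarrow>
        run_state (MR R) (conv ts) \<in> P R \<and> (\<forall>t\<in>set ts. \<kappa> t = \<sigma>)" if "length ts = ?r" for ts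
    proof -
      have "map (\<lambda>i. if i < ?r then ts ! i else Map.empty) [0..<?r] = ts"
        using that by (intro nth_equalityI) auto
      then show ?thesis using that by (simp add: all_set_conv_all_nth)
    qed
    have "lang (conv_alph Sg ?r) M' = conv ` {ts \<in> tuples (factor_dom \<kappa> \<sigma>) ?r. run_state (MR R) (conv ts) \<in> P R}"
    proof -
      have "length ts = ?r \<and> (\<forall>t\<in>set ts. is_tree Sg t) \<and> ?h (\<lambda>i. if i < ?r then ts ! i else Map.empty) \<in> ?F \<longleftrightarrow>
          ts \<in> tuples (factor_dom \<kappa> \<sigma>) ?r \<and> run_state (MR R) (conv ts) \<in> P R" for ts
      proof (cases "length ts = ?r")
        case True
        show ?thesis
          unfolding h_iff[OF True] by (auto simp: True tuples_def factor_dom_def)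
      qed (simp add: tuples_def)
      then show ?thesis
        unfolding M'(2) by blast
    qed
    also have "\<dots> = (\<lambda>xs. conv (map dec xs)) ` rels (factor \<kappa> \<sigma> P) R"
    proof -
      have "map dec (map enc ts) = ts" if "ts \<in> tuples (factor_dom \<kappa> \<sigma>) ?r" for ts
        using that map_dec_enc[of ts \<kappa> \<sigma>] by (simp add: tuples_def)
      then have "(\<lambda>xs. conv (map dec xs)) ` map enc ` {ts \<in> tuples (factor_dom \<kappa> \<sigma>) ?r. run_state (MR R) (conv ts) \<in> P R}
          = conv ` {ts \<in> tuples (factor_dom \<kappa> \<sigma>) ?r. run_state (MR R) (conv ts) \<in> P R}"
        unfolding image_image by (intro image_cong) auto
      then show ?thesis using R by (simp add: factor_def)
    qed
    finally show ?thesis using M'(1) by blast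
  qed
  then obtain MB where MB: "\<And>R. R \<in> Tau \<Longrightarrow> wf_aut (conv_alph Sg (ar R)) (MB R) \<and>
      lang (conv_alph Sg (ar R)) (MB R) = (\<lambda>xs. conv (map dec xs)) ` rels (factor \<kappa> \<sigma> P) R"
    by metis
  have "bij_betw dec (uni (factor \<kappa> \<sigma> P)) (lang Sg N)"
    unfolding N(2) by (rule bij_betw_byWitness[where f' = enc]) (auto simp: factor_def factor_dom_def)
  then show ?thesis
    unfolding tree_automatic_def using finite_Sg N(1) MB by blast
qed

lemma run_state_MR_finite:
  assumes "R \<in> Tau" "\<And>x. x \<in> X \<Longrightarrow> f x \<in> tuples trees (ar R)"
  shows "(\<lambda>x. run_state (MR R) (conv (f x))) ` X \<subseteq> states (MR R)"
proof (rule image_subsetI)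
  fix x assume "x \<in> X"
  from assms(2)[OF this] show "run_state (MR R) (conv (f x)) \<in> states (MR R)"
    by (intro run_state_in_states[OF wf_MR[OF assms(1)]] is_tree_conv) (auto simp: tuples_def)
qed

lemma finite_states_MR: "R \<in> Tau \<Longrightarrow> finite (states (MR R))"
  using wf_MR by (simp add: wf_aut_def)

text \<open>Neither \<open>D\<close> nor an element of \<open>A\<close> occurs, so the same set
  serves all parameters. All values \<open>P R\<close> are taken from one common finite set, with a
  default outside \<open>Tau\<close>, so that there are finitely many functions
  \<open>P\<close>.\<close>

definition factors :: "(nat ltree \<Rightarrow> 'q) \<Rightarrow> (nat, 'r) struc set" where
  "factors \<kappa> = (\<lambda>(\<sigma>, P). factor \<kappa> \<sigma> P) ` (\<kappa> ` trees \<times>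
     {P. \<forall>R. (R \<in> Tau \<longrightarrow> P R \<in> Pow (\<Union>R\<in>Tau. states (MR R))) \<and> (R \<notin> Tau \<longrightarrow> P R = {})})"

lemma finite_factors:
  assumes "tree_congr Sg \<kappa>"
  shows "finite (factors \<kappa>)"
proof -
  have "finite Tau" using sig by (simp add: signature_def)
  then show ?thesis
    unfolding factors_def using tree_congr_finite[OF assms] finite_states_MR
    by (intro finite_imageI[OF finite_cartesian_product] finite_set_of_finite_funs) auto
qed

text \<open>The members of \<open>A\<close> whose tree agrees with that of \<open>a0\<close> on \<open>D\<close> and has subtrees of the
  same types as those of \<open>a0\<close> just below \<open>D\<close>. Such a tree is determined by these subtrees,
  which can be chosen independently of each other.\<close>

definition block :: "(nat ltree \<Rightarrow> 'q) \<Rightarrow> bool list set \<Rightarrow> 'a \<Rightarrow> 'a set" where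
  "block \<kappa> D a0 = {a \<in> uni A. (\<forall>w\<in>D. \<mu> a w = \<mu> a0 w) \<and>
     (\<forall>u\<in>boundary D. \<kappa> (sub u (\<mu> a)) = \<kappa> (sub u (\<mu> a0)))}"

text \<open>The coordinates are the subtrees at the boundary. \<open>\<kappa>_empty\<close> permits
  grafting, \<open>\<kappa>_M\<close> keeps the grafted trees in the universe, and
  \<open>\<kappa>_diag\<close> makes the effect of constant coordinates independent of the
  constants.\<close>

lemma block_tame_box_aug:
  assumes D: "tree_dom D" and a0: "a0 \<in> uni A"
    and \<kappa>_empty: "\<And>t t'. \<kappa> t = \<kappa> t' \<Longrightarrow> t = Map.empty \<longleftrightarrow> t' = Map.empty"
    and \<kappa>_M: "\<And>t t'. \<kappa> t = \<kappa> t' \<Longrightarrow> run_state M t = run_state M t'"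
    and \<kappa>_diag: "\<And>t t' R. R \<in> Tau \<Longrightarrow> \<kappa> t = \<kappa> t' \<Longrightarrow>
      run_state (MR R) (conv (replicate (ar R) t)) = run_state (MR R) (conv (replicate (ar R) t'))"
  shows "\<exists>Bs. set Bs \<subseteq> factors \<kappa> \<and> tame_box_aug Tau ar (restrict A (block \<kappa> D a0)) Bs"
proof -
  define K where "K = block \<kappa> D a0"
  have finD: "finite D" using D by (simp add: tree_dom_def)
  have KA: "K \<subseteq> uni A" by (auto simp: K_def block_def)
  have tK: "is_tree Sg (\<mu> a)" if "a \<in> K" for a
    using that KA mu_tree by blast
  obtain us where us: "set us = boundary D" "distinct us"
    using finite_distinct_list[OF finite_boundary[OF finD]] by blast
  have us_nth: "us ! i \<in> boundary D" if "i < length us" for i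
    using that us(1) nth_mem by blast
  have bd: "\<exists>i<length us. u = us ! i" if "u \<in> boundary D" for u
    using that us(1) by (metis in_set_conv_nth)
  define s where "s i a = sub (us ! i) (\<mu> a)" for i a
  have s_tree: "is_tree Sg (s i a)" if "a \<in> K" for i a
    unfolding s_def by (rule is_tree_sub[OF tK[OF that]])
  have s_\<kappa>: "\<kappa> (s i a) = \<kappa> (s i a0)" if "a \<in> K" "i < length us" for i a
    using that us_nth[OF that(2)] by (simp add: K_def block_def s_def)
  have s_dom: "s i a \<in> factor_dom \<kappa> (\<kappa> (s i a0))" if "a \<in> K" "i < length us" for i a
    using s_tree s_\<kappa> that by (simp add: factor_dom_def)
  have map_s: "map (s i) as \<in> tuples trees r" if "as \<in> tuples K r" for i as r
    using that s_tree by (auto simp: tuples_def)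
  define st where "st R i as = run_state (MR R) (conv (map (s i) as))" for R i as

  \<comment> \<open>Trees of one block agree on \<open>D\<close>, so the run of \<open>MR R\<close>
    on a tuple is determined by the states at the boundary nodes.\<close>
  have rel_cong: "as \<in> rels A R \<longleftrightarrow> as' \<in> rels A R"
    if R: "R \<in> Tau" and as: "as \<in> tuples K (ar R)" "as' \<in> tuples K (ar R)"
      and eq: "\<And>i. i < length us \<Longrightarrow> st R i as = st R i as'" for R as as'
  proof -
    let ?r = "ar R"
    let ?h = "\<lambda>v. run_state (MR R) (conv (map v [0..<?r]))"
    let ?v = "\<lambda>as k. if k < ?r then \<mu> (as ! k) else Map.empty"
    have h: "val_congr Sg ?h"
      by (rule val_congr_conv) (use wf_MR[OF R] in \<open>simp add: tree_congr_run_state\<close>)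
    have nth: "as ! k \<in> K" if "as \<in> tuples K ?r" "k < ?r" for as k
      using that by (auto simp: tuples_def)
    have v: "?v as \<in> vals Sg" if "as \<in> tuples K ?r" for as
      using nth[OF that] tK by (simp add: vals_def)
    have sub: "map (\<lambda>k. sub u (?v as k)) [0..<?r] = map (\<lambda>a. sub u (\<mu> a)) as"
      if "as \<in> tuples K ?r" for as u
      using that by (intro nth_equalityI) (auto simp: tuples_def)
    have "?h (?v as) = ?h (?v as')"
    proof (rule val_congr_boundary[OF h finD v v])
      fix x w assume "w \<in> D"
      then show "?v as x w = ?v as' x w"
        using nth[OF as(1), of x] nth[OF as(2), of x] by (simp add: K_def block_def)
    next
      fix u assume "u \<in> boundary D"
      then obtain i where i: "i < length us" "u = us ! i" using bd by blast
      show "?h (\<lambda>x. sub u (?v as x)) = ?h (\<lambda>x. sub u (?v as' x))"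
        unfolding sub[OF as(1)] sub[OF as(2)] using eq[OF i(1)] by (simp add: st_def s_def[abs_def] i(2))
    qed (use as in auto)
    moreover have "map (?v as) [0..<?r] = map \<mu> as" if "as \<in> tuples K ?r" for as
      using sub[OF that, of "[]"] by simp
    ultimately have eq': "run_state (MR R) (conv (map \<mu> as)) = run_state (MR R) (conv (map \<mu> as'))"
      using as by simp
    have "as \<in> rels A R \<longleftrightarrow> run_state (MR R) (conv (map \<mu> as)) \<in> final (MR R)"
      if "as \<in> tuples K ?r" for as
    proof -
      have "as \<in> tuples (uni A) ?r" using that KA by (auto simp: tuples_def)
      moreover have "is_tree (conv_alph Sg ?r) (conv (map \<mu> as))"
        using that tK by (intro is_tree_conv) (auto simp: tuples_def)
      ultimately show ?thesis
        using rel_iff[OF R] by (simp add: lang_run_state)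
    qed
    then show ?thesis using as eq' by simp
  qed

  \<comment> \<open>Collects the states at coordinate \<open>j\<close> of those related tuples of
    the block that are constant in every other coordinate, since these are the tuples tested by the
    embedding condition.\<close>
  define P where "P j R = (if R \<in> Tau then st R j ` {as \<in> tuples K (ar R). as \<in> rels A R \<and>
      (\<forall>i<length us. i \<noteq> j \<longrightarrow> (\<forall>a\<in>set as. \<forall>b\<in>set as. s i a = s i b))} else {})" for j R
  define B where "B j = factor \<kappa> (\<kappa> (s j a0)) (P j)" for j
  define Bs where "Bs = map B [0..<length us]"
  have len: "length Bs = length us" by (simp add: Bs_def)
  have nthB: "Bs ! j = B j" if "j < length us" for j
    using that by (simp add: Bs_def)
  have uniB: "uni (B j) = enc ` factor_dom \<kappa> (\<kappa> (s j a0))" for j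
    by (simp add: B_def factor_def)
  have B_fac: "B j \<in> factors \<kappa>" for j
  proof -
    have "P j R \<subseteq> states (MR R)" if "R \<in> Tau" for R
      using run_state_MR_finite[OF that, of "tuples K (ar R)" "map (s j)"] map_s that
      by (auto simp: P_def st_def)
    moreover have "P j R = {}" if "R \<notin> Tau" for R
      using that by (simp add: P_def)
    moreover have "s j a0 \<in> trees"
      using mu_tree[OF a0] by (simp add: s_def is_tree_sub)
    ultimately show ?thesis
      unfolding factors_def B_def by (intro image_eqI[of _ _ "(\<kappa> (s j a0), P j)"]) auto
  qed
  then have Bs_fac: "set Bs \<subseteq> factors \<kappa>"
    by (auto simp: Bs_def)

  define g where "g a = map (\<lambda>i. enc (s i a)) [0..<length us]" for a
  have g_nth: "dec (g a ! i) = s i a" if "a \<in> K" "i < length us" for a i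
    using that s_tree by (simp add: g_def)
  have g_prod: "g a \<in> prod_set Bs" if "a \<in> K" for a
    using that s_dom by (simp add: prod_set_def len nthB uniB g_def)
  have g_inj: "inj_on g K"
  proof (rule inj_onI)
    fix a b assume ab: "a \<in> K" "b \<in> K" "g a = g b"
    have "\<mu> a = \<mu> b"
    proof (rule tree_eq_boundary[OF finD])
      show "\<mu> a w = \<mu> b w" if "w \<in> D" for w
        using ab that by (simp add: K_def block_def)
      fix u assume "u \<in> boundary D"
      then obtain i where i: "i < length us" "u = us ! i" using bd by blast
      have "s i a = s i b"
        using ab g_nth[OF _ i(1)] by metis
      then show "sub u (\<mu> a) = sub u (\<mu> b)" by (simp add: s_def i(2))
    qed
    then show "a = b"
      using ab KA mu_inj by (meson inj_onD subsetD)
  qed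
  have g_surj: "\<exists>a\<in>K. g a = xs" if xs: "xs \<in> prod_set Bs" for xs
  proof -
    have lxs: "length xs = length us" using xs by (simp add: prod_set_def len)
    have xs_nth: "dec (xs ! i) \<in> factor_dom \<kappa> (\<kappa> (s i a0))" "enc (dec (xs ! i)) = xs ! i" if "i < length us" for i
    proof -
      have "xs ! i \<in> enc ` factor_dom \<kappa> (\<kappa> (s i a0))"
        using xs that by (simp add: prod_set_def len nthB uniB[symmetric])
      then show "dec (xs ! i) \<in> factor_dom \<kappa> (\<kappa> (s i a0))" "enc (dec (xs ! i)) = xs ! i"
        by (auto simp: factor_dom_def)
    qed
    define b where "b u = dec (the (map_of (zip us xs) u))" for u
    have b: "b (us ! i) = dec (xs ! i)" if "i < length us" for i
      using that us(2) lxs by (simp add: b_def map_of_zip_nth)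
    have b_dom: "b u \<in> factor_dom \<kappa> (\<kappa> (sub u (\<mu> a0)))" if "u \<in> boundary D" for u
    proof -
      obtain i where i: "i < length us" "u = us ! i" using bd \<open>u \<in> boundary D\<close> by blast
      show ?thesis using xs_nth(1)[OF i(1)] b[OF i(1)] by (simp add: i(2) s_def)
    qed
    have "\<exists>t. is_tree Sg t \<and> (\<forall>w\<in>D. t w = \<mu> a0 w) \<and> (\<forall>u\<in>boundary D. sub u t = b u)"
    proof (rule graft_exists[OF D mu_tree[OF a0]])
      fix u assume "u \<in> boundary D"
      from b_dom[OF this] have "is_tree Sg (b u)" "\<kappa> (b u) = \<kappa> (sub u (\<mu> a0))"
        by (simp_all add: factor_dom_def)
      then show "is_tree Sg (b u)" "b u = Map.empty \<longleftrightarrow> sub u (\<mu> a0) = Map.empty"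
        using \<kappa>_empty by blast+
    qed
    then obtain t where t: "is_tree Sg t" "\<forall>w\<in>D. t w = \<mu> a0 w" "\<forall>u\<in>boundary D. sub u t = b u"
      by blast
    have t\<kappa>: "\<kappa> (sub u t) = \<kappa> (sub u (\<mu> a0))" if "u \<in> boundary D" for u
      using b_dom[OF that] t(3) that by (simp add: factor_dom_def)
    \<comment> \<open>The grafted tree must represent an element of \<open>A\<close>: it has the
      labels of \<open>\<mu> a0\<close> on \<open>D\<close> and the same states of \<open>M\<close>
      at the boundary, hence the same root state.\<close>
    have "run_state M t = run_state M (\<mu> a0)"
      by (rule val_congr_boundary[OF val_congr_component[OF tree_congr_run_state[OF wf_M]] finD,
            of "\<lambda>_. t" "\<lambda>_. \<mu> a0"])
        (use t(1,2) \<kappa>_M[OF t\<kappa>] mu_tree[OF a0] in \<open>simp_all add: vals_def\<close>)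
    then have "t \<in> lang Sg M"
      using mu_in_lang[OF a0] t(1) by (simp add: lang_run_state)
    then obtain a where a: "a \<in> uni A" "\<mu> a = t" using mu_surj by blast
    then have "a \<in> K"
      using t t\<kappa> by (simp add: K_def block_def)
    moreover have "g a = xs"
    proof (rule nth_equalityI)
      fix i assume "i < length (g a)"
      then have i: "i < length us" by (simp add: g_def)
      show "g a ! i = xs ! i"
        using i t(3) us_nth[OF i] b[OF i] xs_nth(2)[OF i] by (simp add: g_def s_def a(2))
    qed (simp add: g_def lxs)
    ultimately show ?thesis by blast
  qed
  have g_bij: "bij_betw g K (prod_set Bs)"
    using g_inj g_prod g_surj unfolding bij_betw_def by blast
  \<comment> \<open>A box augmentation asks for the map from the product into the structure, which
    is the inverse of the coordinate map \<open>g\<close>.\<close>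
  define f where "f = inv_into K g"
  have f_bij: "bij_betw f (prod_set Bs) K"
    unfolding f_def by (rule bij_betw_inv_into[OF g_bij])
  have fK: "f xs \<in> K" if "xs \<in> prod_set Bs" for xs
    using bij_betwE[OF f_bij] that by blast
  have gf: "g (f xs) = xs" if "xs \<in> prod_set Bs" for xs
    unfolding f_def using bij_betw_inv_into_right[OF g_bij that] .
  have f_inv: "inv_into (prod_set Bs) f a = g a" if "a \<in> K" for a
  proof (rule inv_into_f_eq[OF bij_betw_imp_inj_on[OF f_bij] g_prod[OF that]])
    show "f (g a) = a"
      unfolding f_def using bij_betw_inv_into_left[OF g_bij that] .
  qed
  have sf: "s i (f xs) = dec (xs ! i)" if "xs \<in> prod_set Bs" "i < length us" for xs i
    using g_nth[OF fK[OF that(1)] that(2)] gf[OF that(1)] by simp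

  have emb: "embedding Tau ar (Bs ! j) (restrict A K) (\<lambda>b. f (xs[j := b]))"
    if j: "j < length Bs" and xs: "xs \<in> prod_set Bs" for j xs
  proof -
    let ?e = "\<lambda>b. f (xs[j := b])"
    have j': "j < length us" using j len by simp
    have lxs: "length xs = length us" using xs by (simp add: prod_set_def len)
    have upd: "xs[j := b] \<in> prod_set Bs" if "b \<in> uni (Bs ! j)" for b
      using xs that j by (auto simp: prod_set_def nth_list_update)
    have "inj_on ?e (uni (Bs ! j))"
    proof (rule inj_onI)
      fix b b' assume bb: "b \<in> uni (Bs ! j)" "b' \<in> uni (Bs ! j)" "?e b = ?e b'"
      then have "xs[j := b] = xs[j := b']"
        using gf upd by metis
      then have "xs[j := b] ! j = xs[j := b'] ! j" by simp
      then show "b = b'" using j' lxs by simp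
    qed
    moreover have "?e ` uni (Bs ! j) \<subseteq> uni (restrict A K)"
      using fK upd by (auto simp: restrict_def)
    moreover have "bs \<in> rels (Bs ! j) R \<longleftrightarrow> map ?e bs \<in> rels (restrict A K) R"
      if R: "R \<in> Tau" and bs: "bs \<in> tuples (uni (Bs ! j)) (ar R)" for R bs
    proof -
      define as where "as = map ?e bs"
      have bsB: "b \<in> uni (Bs ! j)" if "b \<in> set bs" for b
        using bs that by (auto simp: tuples_def)
      have as: "as \<in> tuples K (ar R)"
        using bs fK upd bsB by (auto simp: as_def tuples_def)
      have sj: "map (s j) as = map dec bs"
        using bsB upd sf j' lxs by (simp add: as_def)
      have si: "s i a = dec (xs ! i)" if "i < length us" "i \<noteq> j" "a \<in> set as" for i a
        using that bsB upd sf by (auto simp: as_def)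
      have rel: "map ?e bs \<in> rels (restrict A K) R \<longleftrightarrow> as \<in> rels A R"
        using as by (auto simp: restrict_def tuples_def as_def[symmetric])
      have fac: "bs \<in> rels (Bs ! j) R \<longleftrightarrow> st R j as \<in> P j R"
        using rels_factor[OF R, of bs \<kappa> "\<kappa> (s j a0)" "P j"] bs
        by (simp add: nthB[OF j'] B_def st_def sj)
      \<comment> \<open>The tuple \<open>as'\<close> behind the state may have other constants
        outside coordinate \<open>j\<close>. By \<open>\<kappa>_diag\<close> diagonal tuples of
        equal type reach the same state, so all boundary states of \<open>as\<close> and
        \<open>as'\<close> agree.\<close>
      have "as \<in> rels A R" if stP: "st R j as \<in> P j R"
      proof -
        obtain as' where as': "as' \<in> tuples K (ar R)" "as' \<in> rels A R" "st R j as = st R j as'"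
          and const: "\<And>i a b. i < length us \<Longrightarrow> i \<noteq> j \<Longrightarrow> a \<in> set as' \<Longrightarrow> b \<in> set as' \<Longrightarrow> s i a = s i b"
          using stP R by (auto simp: P_def)
        have "st R i as = st R i as'" if i: "i < length us" for i
        proof (cases "i = j")
          case False
          \<comment> \<open>Positive arity provides a head entry, which names the constant repeated
            in coordinate \<open>i\<close>.\<close>
          have r: "ar R \<ge> 1" using sig R by (simp add: signature_def)
          have "length as' = ar R" "length as = ar R"
            using as as'(1) by (simp_all add: tuples_def)
          then have ne: "as' \<noteq> []" "as \<noteq> []" using r by auto
          have rep: "map (s i) cs = replicate (ar R) (s i (hd cs))"
            if "cs \<in> tuples K (ar R)" "\<And>a. a \<in> set cs \<Longrightarrow> s i a = s i (hd cs)" for cs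
            using that by (intro nth_equalityI) (auto simp: tuples_def)
          have rep_as': "map (s i) as' = replicate (ar R) (s i (hd as'))"
            by (rule rep[OF as'(1)]) (rule const[OF i False _ hd_in_set[OF ne(1)]])
          have rep_as: "map (s i) as = replicate (ar R) (s i (hd as))"
            by (rule rep[OF as]) (simp add: si[OF i False] hd_in_set[OF ne(2)])
          have "hd as' \<in> K" "hd as \<in> K"
            using ne as as'(1) hd_in_set[of as] hd_in_set[of as'] by (auto simp: tuples_def)
          then have "\<kappa> (s i (hd as)) = \<kappa> (s i (hd as'))"
            by (simp only: s_\<kappa>[OF _ i])
          from \<kappa>_diag[OF R this] show ?thesis
            unfolding st_def rep_as rep_as' .
        qed (use as'(3) in simp)
        then show ?thesis using rel_cong[OF R as as'(1)] as'(2) by blast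
      qed
      moreover have "st R j as \<in> P j R" if "as \<in> rels A R"
        using that as si R by (auto simp: P_def)
      ultimately show ?thesis using rel fac by blast
    qed
    ultimately show ?thesis unfolding embedding_def by blast
  qed
  have box: "box_aug Tau ar (restrict A K) Bs f"
    unfolding box_aug_def using f_bij emb by (simp add: restrict_def)

  have "\<exists>cs :: nat \<Rightarrow> nat list \<Rightarrow> nat. (\<forall>i<length Bs. colouring ar (Bs ! i) R (cs i)) \<and>
        colouring ar (restrict A K) R (\<lambda>t. map (\<lambda>i. cs i (map (\<lambda>k. inv_into (prod_set Bs) f (t ! k) ! i) [0..<ar R]))
           [0..<length Bs])" if R: "R \<in> Tau" for R
  proof -
    \<comment> \<open>The same colour, the state of \<open>MR R\<close>, serves every coordinate.
      The combined colour is then the vector of boundary states, and tameness reduces to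
      \<open>rel_cong\<close>.\<close>
    define c where "c bs = run_state (MR R) (conv (map dec bs))" for bs
    have "colouring ar (Bs ! i) R c" if "i < length Bs" for i
    proof (rule colouringI)
      have Bi: "Bs ! i = factor \<kappa> (\<kappa> (s i a0)) (P i)"
        using that by (simp add: nthB len B_def)
      have "map dec bs \<in> tuples trees (ar R)" if "bs \<in> tuples (uni (Bs ! i)) (ar R)" for bs
        using tuples_factor(1)[OF that[unfolded Bi]] by (auto simp: tuples_def factor_dom_def)
      then have "c ` tuples (uni (Bs ! i)) (ar R) \<subseteq> states (MR R)"
        unfolding c_def by (rule run_state_MR_finite[OF R])
      then show "finite (c ` tuples (uni (Bs ! i)) (ar R))"
        using finite_states_MR[OF R] finite_subset by blast
      fix t t' assume t: "t \<in> tuples (uni (Bs ! i)) (ar R)" "t' \<in> tuples (uni (Bs ! i)) (ar R)"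
        "c t = c t'" "t' \<in> rels (Bs ! i) R"
      then show "t \<in> rels (Bs ! i) R"
        unfolding Bi rels_factor[OF R t(1)[unfolded Bi]] rels_factor[OF R t(2)[unfolded Bi]]
        by (simp only: c_def)
    qed
    moreover have "colouring ar (restrict A K) R (\<lambda>t. map (\<lambda>i. c (map (\<lambda>k. inv_into (prod_set Bs) f (t ! k) ! i) [0..<ar R]))
           [0..<length Bs])" (is "colouring _ _ _ ?c")
    proof (rule colouringI)
      have uK: "uni (restrict A K) = K" by (simp add: restrict_def)
      have c_st: "?c as = map (\<lambda>i. st R i as) [0..<length us]" if as: "as \<in> tuples K (ar R)" for as
      proof -
        have "map dec (map (\<lambda>k. inv_into (prod_set Bs) f (as ! k) ! i) [0..<ar R]) = map (s i) as"
          if "i < length us" for i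
        proof (rule nth_equalityI)
          fix k assume "k < length (map dec (map (\<lambda>k. inv_into (prod_set Bs) f (as ! k) ! i) [0..<ar R]))"
          then have k: "k < ar R" by simp
          then have "as ! k \<in> K" "k < length as" using as by (auto simp: tuples_def)
          then show "map dec (map (\<lambda>k. inv_into (prod_set Bs) f (as ! k) ! i) [0..<ar R]) ! k = map (s i) as ! k"
            using k f_inv g_nth \<open>i < length us\<close> by simp
        qed (use as in \<open>simp add: tuples_def\<close>)
        then show ?thesis by (simp add: c_def st_def len)
      qed
      have "?c ` tuples K (ar R) \<subseteq> {l. set l \<subseteq> states (MR R) \<and> length l = length us}"
      proof (rule image_subsetI)
        fix as assume as: "as \<in> tuples K (ar R)"
        have "st R i as \<in> states (MR R)" for i
          using run_state_MR_finite[OF R, of "tuples K (ar R)" "map (s i)"] map_s as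
          by (auto simp: st_def)
        then show "?c as \<in> {l. set l \<subseteq> states (MR R) \<and> length l = length us}"
          unfolding c_st[OF as] by auto
      qed
      then show "finite (?c ` tuples (uni (restrict A K)) (ar R))"
        unfolding uK using finite_lists_length_eq[OF finite_states_MR[OF R]] finite_subset by blast
      fix t t' assume t: "t \<in> tuples (uni (restrict A K)) (ar R)" "t' \<in> tuples (uni (restrict A K)) (ar R)"
        and eq: "?c t = ?c t'" and rel: "t' \<in> rels (restrict A K) R"
      have tK: "t \<in> tuples K (ar R)" "t' \<in> tuples K (ar R)"
        using t by (simp_all add: uK)
      have map_eq: "map (\<lambda>i. st R i t) [0..<length us] = map (\<lambda>i. st R i t') [0..<length us]"
        using eq unfolding c_st[OF tK(1)] c_st[OF tK(2)] .
      have "st R i t = st R i t'" if "i < length us" for i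
        using arg_cong[OF map_eq, of "\<lambda>l. l ! i"] that by simp
      then have "t \<in> rels A R \<longleftrightarrow> t' \<in> rels A R"
        by (rule rel_cong[OF R tK])
      then show "t \<in> rels (restrict A K) R"
        using rel tK by (simp add: restrict_def tuples_def)
    qed
    ultimately show ?thesis by (intro exI[of _ "\<lambda>_. c"] conjI allI impI)
  qed
  then have "tame_box_aug Tau ar (restrict A K) Bs"
    unfolding tame_box_aug_def using box by blast
  then show ?thesis using Bs_fac by (auto simp: K_def)
qed

section \<open>Decomposition of definable sets into blocks\<close>

lemma iso_refl: "iso Tau ar B B"
  unfolding iso_def embedding_def by (intro exI[of _ id]) auto

text \<open>The type function \<open>\<kappa>\<close> is built from the presentation,
  \<open>phi\<close> and \<open>n\<close> before \<open>s\<close> is chosen, so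
  \<open>factors \<kappa>\<close> can be the required set; the parameters influence only
  \<open>D\<close> and the resulting blocks.\<close>

lemma defset_decomposition:
  assumes phi: "fo_over Tau ar phi"
  shows "\<exists>S :: (nat, 'r) struc set. finite S \<and>
           (\<forall>B\<in>S. struc_of Tau ar B \<and> tree_automatic Tau ar B) \<and>
           (\<forall>s. length s = n \<and> set s \<subseteq> uni A \<longrightarrow>
              (\<exists>Cs :: ('a, 'r) struc list.
                 sum_aug Tau ar (restrict A (defset A phi s)) Cs \<and>
                 (\<forall>C\<in>set Cs. struc_of Tau ar C \<and>
                    (\<exists>Bs. set Bs \<subseteq> S \<and> tame_box_aug Tau ar C Bs))))"
proof -
  obtain Q where Q: "recognisable Sg Q" "\<And>v. range v \<subseteq> uni A \<Longrightarrow> sat A v phi \<longleftrightarrow> Q (\<lambda>x. \<mu> (v x))"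
    using sat_recognisable[OF phi] by blast
  then obtain h :: "(nat \<Rightarrow> nat ltree) \<Rightarrow> nat" and F
    where h: "val_congr Sg h" and hF: "\<And>v. v \<in> vals Sg \<Longrightarrow> Q v \<longleftrightarrow> h v \<in> F"
    unfolding recognisable_def by blast
  \<comment> \<open>Exactly these variables are parameters. \<open>assign\<close> gives the element
    itself to variable 0 and to every variable beyond \<open>n\<close>, so at the boundary all
    variables but the parameters carry the same subtree.\<close>
  let ?par = "\<lambda>k. 1 \<le> k \<and> k \<le> n"
  define diag where "diag t R = (if R \<in> Tau then run_state (MR R) (conv (replicate (ar R) t)) else undefined)" for t R
  \<comment> \<open>The first, second and fourth entries serve \<open>block_tame_box_aug\<close>;
    the third is the state of the formula when all parameter trees are exhausted.\<close>
  define \<kappa> where "\<kappa> t = (t = Map.empty, run_state M t, h (\<lambda>k. if ?par k then Map.empty else t), diag t)" for t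
  \<comment> \<open>Repeating variable 0 yields the diagonal tuples; one function valued in states
    handles all of the finitely many relation symbols.\<close>
  have "val_congr Sg (\<lambda>v R. if R \<in> Tau then run_state (MR R) (conv (map v (replicate (ar R) 0))) else undefined)"
    by (intro val_congr_family val_congr_conv)
      (use sig wf_MR in \<open>simp_all add: signature_def tree_congr_run_state\<close>)
  from tree_congr_of_val_congr[OF this, of "\<lambda>_. False"] have diag: "tree_congr Sg diag"
    unfolding diag_def[abs_def] map_replicate if_False .
  have \<kappa>: "tree_congr Sg \<kappa>"
    unfolding \<kappa>_def
    by (intro tree_congr_Pair tree_congr_empty tree_congr_run_state[OF wf_M]
        tree_congr_of_val_congr[OF h] diag)
  have blocks: "\<exists>Bs. set Bs \<subseteq> factors \<kappa> \<and> tame_box_aug Tau ar (restrict A (block \<kappa> D a)) Bs"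
    if "tree_dom D" "a \<in> uni A" for D a
  proof (rule block_tame_box_aug[OF that])
    fix t t' R assume R: "R \<in> Tau" and "\<kappa> t = \<kappa> t'"
    then have "diag t R = diag t' R" by (simp add: \<kappa>_def)
    then show "run_state (MR R) (conv (replicate (ar R) t)) = run_state (MR R) (conv (replicate (ar R) t'))"
      using R by (simp add: diag_def)
  qed (simp_all add: \<kappa>_def)
  have "\<exists>Cs :: ('a, 'r) struc list. sum_aug Tau ar (restrict A (defset A phi s)) Cs \<and>
      (\<forall>C\<in>set Cs. struc_of Tau ar C \<and> (\<exists>Bs. set Bs \<subseteq> factors \<kappa> \<and> tame_box_aug Tau ar C Bs))"
    if s: "length s = n" "set s \<subseteq> uni A" for s
  proof -
    define D where "D = (\<Union>a\<in>set s. dom (\<mu> a))"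
    have D: "tree_dom D"
    proof -
      have "tree_dom (dom (\<mu> a))" if "a \<in> set s" for a
        using mu_tree that s(2) unfolding is_tree_def by blast
      then show ?thesis
        unfolding D_def by (rule tree_dom_UN[OF finite_set])
    qed
    have finD: "finite D" using D by (simp add: tree_dom_def)
    have param_outside: "sub u (\<mu> a) = Map.empty" if "u \<in> boundary D" "a \<in> set s" for u a
      using that mu_tree s(2) by (intro sub_outside[of Sg]) (auto simp: D_def boundary_def)
    have assign_range: "range (assign a s) \<subseteq> uni A" if "a \<in> uni A" for a
      using that s(2) by (auto simp: assign_def subset_iff)
    have assign_param: "assign a s k = s ! (k - 1) \<and> s ! (k - 1) \<in> set s" if "?par k" for a k
      using that s(1) by (auto simp: assign_def)
    have assign_free: "assign a s k = a" if "\<not> ?par k" for a k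
      using that s(1) by (auto simp: assign_def)
    define X where "X = defset A phi s"
    have XA: "X \<subseteq> uni A" by (auto simp: X_def defset_def)
    \<comment> \<open>The definable set is a union of blocks: members of a block agree on
      \<open>D\<close> and reach the same states of the formula at the boundary, where the
      parameters are empty.\<close>
    have block_X: "b \<in> X" if a: "a \<in> X" and b: "b \<in> block \<kappa> D a" for a b
    proof -
      have ab: "a \<in> uni A" "b \<in> uni A"
        using a b XA by (auto simp: block_def)
      let ?v = "\<lambda>a k. \<mu> (assign a s k)"
      have v: "?v a \<in> vals Sg" if "a \<in> uni A" for a
        using assign_range[OF that] mu_tree by (auto simp: vals_def)
      have out: "(\<lambda>k. sub u (?v a k)) = (\<lambda>k. if ?par k then Map.empty else sub u (\<mu> a))"
        if "u \<in> boundary D" for u a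
        using assign_param assign_free param_outside[OF that] by auto
      have "h (?v a) = h (?v b)"
      proof (rule val_congr_boundary[OF h finD v[OF ab(1)] v[OF ab(2)]])
        fix k w assume "w \<in> D"
        then have "\<mu> b w = \<mu> a w" using b by (simp add: block_def)
        then show "?v a k w = ?v b k w"
          using assign_param assign_free by metis
      next
        fix u assume u: "u \<in> boundary D"
        then have "\<kappa> (sub u (\<mu> b)) = \<kappa> (sub u (\<mu> a))"
          using b by (simp add: block_def)
        then show "h (\<lambda>k. sub u (?v a k)) = h (\<lambda>k. sub u (?v b k))"
          unfolding out[OF u] by (simp add: \<kappa>_def)
      qed
      then have "Q (?v a) \<longleftrightarrow> Q (?v b)"
        using hF v ab by simp
      then have "sat A (assign a s) phi \<longleftrightarrow> sat A (assign b s) phi"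
        using Q(2)[OF assign_range] ab by simp
      then show ?thesis
        using a ab by (simp add: X_def defset_def)
    qed
    \<comment> \<open>Fixed defaults outside \<open>D\<close> and its boundary make equality of keys
      the same as lying in one block, and leave only finitely many keys.\<close>
    define key where "key a = (\<mu> a |` D, \<lambda>u. if u \<in> boundary D then \<kappa> (sub u (\<mu> a)) else undefined)" for a
    have block_eq: "block \<kappa> D a = {b \<in> X. key b = key a}" if a: "a \<in> X" for a
    proof -
      have "key b = key a \<longleftrightarrow> (\<forall>w\<in>D. \<mu> b w = \<mu> a w) \<and> (\<forall>u\<in>boundary D. \<kappa> (sub u (\<mu> b)) = \<kappa> (sub u (\<mu> a)))" for b
        unfolding key_def prod.inject fun_eq_iff restrict_map_def by auto
      then show ?thesis
        using block_X[OF a] XA by (auto simp: block_def)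
    qed
    let ?G = "{f. \<forall>w. (w \<in> D \<longrightarrow> f w \<in> insert None (Some ` Sg)) \<and> (w \<notin> D \<longrightarrow> f w = None)}"
    let ?H = "{f. \<forall>u. (u \<in> boundary D \<longrightarrow> f u \<in> \<kappa> ` trees) \<and> (u \<notin> boundary D \<longrightarrow> f u = undefined)}"
    have "finite (key ` X)"
    proof (rule finite_subset)
      show "key ` X \<subseteq> ?G \<times> ?H"
      proof (rule image_subsetI)
        fix a assume "a \<in> X"
        then have t: "is_tree Sg (\<mu> a)" using XA mu_tree by blast
        have "\<mu> a w \<in> insert None (Some ` Sg)" for w
          using is_tree_label[OF t, of w] by (cases "\<mu> a w") auto
        then have "\<mu> a |` D \<in> ?G" by (simp add: restrict_map_def)
        moreover have "(\<lambda>u. if u \<in> boundary D then \<kappa> (sub u (\<mu> a)) else undefined) \<in> ?H"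
          using is_tree_sub[OF t] by simp
        ultimately show "key a \<in> ?G \<times> ?H"
          unfolding key_def by (rule SigmaI)
      qed
      show "finite (?G \<times> ?H)"
        by (intro finite_cartesian_product finite_set_of_finite_funs)
          (use finD finite_boundary[OF finD] finite_Sg tree_congr_finite[OF \<kappa>] in simp_all)
    qed
    \<comment> \<open>Each key is listed once, so the summands are finitely many and pairwise
      disjoint.\<close>
    from finite_distinct_list[OF this] obtain ks where ks: "set ks = key ` X" "distinct ks"
      by blast
    define As where "As = map (\<lambda>k. {b \<in> X. key b = k}) ks"
    define Cs where "Cs = map (restrict A) As"
    have AsX: "As ! i \<subseteq> X" if "i < length As" for i
      using that by (auto simp: As_def)
    have "sum_aug Tau ar (restrict A X) Cs"
      unfolding sum_aug_def
    proof (intro exI[of _ As] conjI allI impI)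
      show "length As = length Cs" by (simp add: Cs_def)
      show "As ! i \<inter> As ! j = {}" if "i < length As" "j < length As" "i \<noteq> j" for i j
        using that ks(2) by (auto simp: As_def nth_eq_iff_index_eq)
      show "\<Union> (set As) = uni (restrict A X)"
        using ks(1) by (auto simp: As_def restrict_def)
      show "iso Tau ar (restrict (restrict A X) (As ! i)) (Cs ! i)" if "i < length Cs" for i
        using that restrict_restrict[OF AsX, of i A] iso_refl by (simp add: Cs_def)
    qed
    moreover have "struc_of Tau ar C \<and> (\<exists>Bs. set Bs \<subseteq> factors \<kappa> \<and> tame_box_aug Tau ar C Bs)"
      if C: "C \<in> set Cs" for C
    proof -
      obtain k where "k \<in> set ks" "C = restrict A {b \<in> X. key b = k}"
        using C by (auto simp: Cs_def As_def)
      then obtain a where a: "a \<in> X" "C = restrict A {b \<in> X. key b = key a}"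
        unfolding ks(1) by blast
      then have "C = restrict A (block \<kappa> D a)" using block_eq by simp
      then show ?thesis
        using blocks[OF D] a(1) XA struc_of_restrict[OF struc] by blast
    qed
    ultimately show ?thesis unfolding X_def by blast
  qed
  then show ?thesis
    using finite_factors[OF \<kappa>] tree_automatic_factor[OF \<kappa>] struc_of_factor
    by (intro exI[of _ "factors \<kappa>"]) (auto simp: factors_def)
qed

end

theorem theorem3p8:
  fixes Tau :: "'r set" and ar :: "'r \<Rightarrow> nat" and A :: "('a, 'r) struc"
    and phi :: "'r fo" and n :: nat
  assumes "signature Tau ar"
    and "struc_of Tau ar A"
    and "tree_automatic Tau ar A"
    and "fo_over Tau ar phi"
    and "fv phi \<subseteq> {..n}"
  shows "\<exists>S :: (nat, 'r) struc set. finite S \<and>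
           (\<forall>B\<in>S. struc_of Tau ar B \<and> tree_automatic Tau ar B) \<and>
           (\<forall>s. length s = n \<and> set s \<subseteq> uni A \<longrightarrow>
              (\<exists>Cs :: ('a, 'r) struc list.
                 sum_aug Tau ar (restrict A (defset A phi s)) Cs \<and>
                 (\<forall>C\<in>set Cs. struc_of Tau ar C \<and>
                    (\<exists>Bs. set Bs \<subseteq> S \<and> tame_box_aug Tau ar C Bs))))"
proof -
  obtain Sg :: "nat set" and M MR \<mu> where "finite Sg" "wf_aut Sg M" "bij_betw \<mu> (uni A) (lang Sg M)"
    "\<forall>R\<in>Tau. wf_aut (conv_alph Sg (ar R)) (MR R) \<and>
       lang (conv_alph Sg (ar R)) (MR R) = (\<lambda>xs. conv (map \<mu> xs)) ` rels A R"
    using assms(3) unfolding tree_automatic_def by (elim exE conjE)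
  then interpret tree_presentation Tau ar A Sg M MR \<mu>
    by unfold_locales (simp_all add: assms(1,2))
  show ?thesis
    by (rule defset_decomposition[OF assms(4)])
qed

end
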